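(* Let $n$ be a positive integer, let $0<p_1<p_2<\cdots<p_n$ be real numbers, let $r>0$ be a real number, and let $K_r$ be the $n\times n$ real symmetric matrix whose $(i,j)$ entry is $\frac{p_i^r+p_j^r}{p_i+p_j}$. For each positive real $s$, let $K_s$ denote the matrix defined in the same way with the exponent $r$ replaced by $s$ (same $n$ and same $p_1,\ldots,p_n$). Then: (i) $K_r$ is singular if and only if $r$ is an odd integer smaller than $n$. (ii) When $r$ is an odd integer smaller than or equal to $n$, $$\mathrm{In}\, K_r=\begin{cases}\left(\lceil\frac{r}{2}\rceil,\; n-r,\;\lfloor\frac{r}{2}\rfloor\right) & \text{if } r\equiv 1 \pmod 4,\\[2pt] \left(\lfloor\frac{r}{2}\rfloor,\; n-r,\;\lceil\frac{r}{2}\rceil\right) & \text{if } r\equiv 3 \pmod 4.\end{cases}$$ (iii) Suppose $k<r<k+2<n$, where $k$ is an odd integer. Then $$\mathrm{In}\, K_r=\begin{cases}\left(\lceil\frac{k}{2}\rceil,\;0,\;n-\lceil\frac{k}{2}\rceil\right) & \text{if } k\equiv 1 \pmod 4,\\[2pt] \left(n-\lceil\frac{k}{2}\rceil,\;0,\;\lceil\frac{k}{2}\rceil\right) & \text{if } k\equiv 3 \pmod 4.\end{cases}$$ (iv) If $n$ is odd, then $\mathrm{In}\, K_r=\mathrm{In}\, K_n$ for $r>n-2$; and if $n$ is even, then $\mathrm{In}\, K_r=\mathrm{In}\, K_n=\left(\frac{n}{2},0,\frac{n}{2}\right)$ for $r>n-1$.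
   Context: For an $n\times n$ Hermitian matrix $A$, the inertia of $A$ is the triple $\mathrm{In}(A)=(\pi(A),\zeta(A),\nu(A))$, where $\pi(A)$, $\zeta(A)$ and $\nu(A)$ are respectively the numbers of positive, zero and negative eigenvalues of $A$, counted with multiplicity. $\lceil\cdot\rceil$ and $\lfloor\cdot\rfloor$ denote the ceiling and floor functions. *)

theory Defs
  imports Complex_Main "Jordan_Normal_Form.Char_Poly"
begin

text \<open>Meant for Hermitian \<open>A\<close>: all eigenvalues are then real, so it suffices to range over real
  \<open>x\<close>; each eigenvalue is counted with its multiplicity as a root of the characteristic polynomial.\<close>
definition eigenvalue_count :: "complex mat \<Rightarrow> (real \<Rightarrow> bool) \<Rightarrow> nat" where
  "eigenvalue_count A P =
     (\<Sum>x | eigenvalue A (complex_of_real x) \<and> P x.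
        Polynomial.order (complex_of_real x) (char_poly A))"

definition inertia :: "complex mat \<Rightarrow> nat \<times> nat \<times> nat" where
  "inertia A = (eigenvalue_count A (\<lambda>x. x > 0),
                eigenvalue_count A (\<lambda>x. x = 0),
                eigenvalue_count A (\<lambda>x. x < 0))"

text \<open>Indices run over \<open>0, \<dots>, n - 1\<close>, so \<open>p i\<close> is the mathematical $p_{i+1}$.\<close>
definition kwong_mat :: "nat \<Rightarrow> (nat \<Rightarrow> real) \<Rightarrow> real \<Rightarrow> real mat" where
  "kwong_mat n p s = mat n n (\<lambda>(i, j). (p i powr s + p j powr s) / (p i + p j))"

abbreviation kwong_inertia :: "nat \<Rightarrow> (nat \<Rightarrow> real) \<Rightarrow> real \<Rightarrow> nat \<times> nat \<times> nat" where
  "kwong_inertia n p s \<equiv> inertia (map_mat complex_of_real (kwong_mat n p s))"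

end

theory Submission
  imports Defs
begin

text \<open>
  Write \<open>K r\<close> for the Kwong matrix of the nodes \<open>0 < p\<^sub>1 < \<dots> < p\<^sub>n\<close>.

  \<^emph>\<open>Nonsingularity.\<close> If \<open>K r * c = 0\<close>, clearing denominators in
  \<open>\<Sum>\<^sub>j c\<^sub>j (x\<^sup>r + p\<^sub>j\<^sup>r) / (x + p\<^sub>j)\<close> gives \<open>x\<^sup>r P(x) + Q(x)\<close> with polynomials
  \<open>P\<close>, \<open>Q\<close> of degree below \<open>n\<close> that vanishes at every node. By construction also
  \<open>Q(-p\<^sub>i) = p\<^sub>i\<^sup>r P(-p\<^sub>i)\<close>. Adding and subtracting the two relations shows that
  \<open>x\<^sup>r P\<^sub>e + Q\<^sub>o\<close> and \<open>x\<^sup>r P\<^sub>o + Q\<^sub>e\<close> (even and odd parts) vanish at the nodes separately.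
  Each has only \<open>n\<close> monomials, with exponents \<open>r + l\<close> and \<open>l'\<close> where \<open>l - l'\<close> is odd; these are distinct
  unless \<open>r\<close> is an odd integer with \<open>\<bar>r\<bar> < n\<close>. By Descartes' rule of signs for real exponents
  a nonzero combination has at most \<open>n - 1\<close> positive zeros, so \<open>P = 0\<close> and hence \<open>c = 0\<close>
  (\<open>kwong_kernel_trivial\<close>).

  \<^emph>\<open>Odd integer exponents.\<close> For \<open>r = 2 h + 1 \<le> n\<close> the quotient
  \<open>(x\<^sup>r + y\<^sup>r) / (x + y)\<close> is a polynomial, so the quadratic form is an explicit alternating form in the \<open>r\<close>
  independent moments \<open>\<Sum>\<^sub>j p\<^sub>j\<^sup>l c\<^sub>j\<close>; its signature can be read off (\<open>kwong_odd_signature\<close>).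

  \<^emph>\<open>Other exponents.\<close> The inertia is constant along intervals of \<open>r\<close> on which \<open>K r\<close> is nonsingular.
  On \<open>(-1, 1)\<close> all \<open>K r\<close> are positive definite, because \<open>K 0\<close>
  is twice a Cauchy matrix. The identity
  \<open>(x\<^sup>r + y\<^sup>r) / (x + y) = x\<^bsup>r-1\<^esup> + y\<^bsup>r-1\<^esup> - x y (x\<^bsup>r-2\<^esup> + y\<^bsup>r-2\<^esup>) / (x + y)\<close>
  shifts \<open>r\<close> by \<open>2\<close> at the price of a sign on the space of vectors whose first moments vanish, so for
  \<open>2 M - 1 < r < 2 M + 1\<close> at least \<open>n - M\<close> eigenvalues have the sign \<open>(-1)\<^sup>M\<close>
  (\<open>kwong_definite_on_codim\<close>). Moreover, for odd size \<open>N = 2 M + 1\<close> there is no singular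
  exponent beyond \<open>N - 2\<close>, and the inertia there is the known one at \<open>r = N\<close>
  (\<open>kwong_odd_size_signature\<close>). Principal submatrices of this odd size supply the missing
  \<open>M\<close> eigenvalues of the opposite sign (\<open>kwong_between_odd_signature\<close>), and a matrix of even size is
  squeezed between two of odd size (\<open>kwong_even_size_signature\<close>).

  All eigenvalue counts enter through one principle: if the form of a symmetric matrix of size \<open>n\<close> has a fixed
  sign on the solutions of \<open>k\<close> linear equations, then at least \<open>n - k\<close> eigenvalues have that sign
  (\<open>definite_on_codim\<close>). Lower bounds that add up to \<open>n\<close> are equalities.
\<close>

section \<open>The spectral theorem for real symmetric matrices\<close>

text \<open>The characteristic polynomial has a complex root; it is real because the Hermitian form
  \<open>v\<^sup>* A v = z (v\<^sup>* v)\<close> of an eigenvector is real.\<close>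
lemma real_symmetric_has_real_eigenvalue:
  fixes A :: "real mat"
  assumes A: "A \<in> carrier_mat n n" and sym: "transpose_mat A = A" and n: "n > 0"
  shows "\<exists>e. eigenvalue A e"
proof -
  let ?C = "map_mat complex_of_real A"
  have C: "?C \<in> carrier_mat n n" using A by auto
  have "degree (char_poly ?C) \<noteq> 0" using degree_monic_char_poly[OF C] n by auto
  then obtain z where z: "poly (char_poly ?C) z = 0"
    using fundamental_theorem_of_algebra[of "char_poly ?C"] by (auto simp: constant_degree)
  then have "eigenvalue ?C z" using eigenvalue_root_char_poly[OF C] by auto
  then obtain v where v: "v \<in> carrier_vec n" "v \<noteq> 0\<^sub>v n" "?C *\<^sub>v v = z \<cdot>\<^sub>v v"
    using C unfolding eigenvalue_def eigenvector_def by auto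
  have ev: "(\<Sum>j<n. complex_of_real (A $$ (i,j)) * v $ j) = z * v $ i" if "i < n" for i
  proof -
    have "(?C *\<^sub>v v) $ i = (z \<cdot>\<^sub>v v) $ i" using v(3) by simp
    then show ?thesis using that A v(1)
      by (simp add: scalar_prod_def lessThan_atLeast0)
  qed
  have A_sym: "A $$ (i,j) = A $$ (j,i)" if "i < n" "j < n" for i j
    using arg_cong[OF sym, of "\<lambda>M. M $$ (i,j)"] that A by auto
  define N where "N = (\<Sum>i<n. cnj (v $ i) * v $ i)"
  have N_re: "N = of_real (\<Sum>i<n. (cmod (v $ i))\<^sup>2)"
    unfolding N_def by (simp add: complex_norm_square mult.commute del: of_real_power)
  have "(\<Sum>i<n. (cmod (v $ i))\<^sup>2) \<noteq> 0"
  proof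
    assume "(\<Sum>i<n. (cmod (v $ i))\<^sup>2) = 0"
    then have "\<forall>i<n. v $ i = 0" by (subst (asm) sum_nonneg_eq_0_iff) auto
    then have "v = 0\<^sub>v n" using v(1) by (intro eq_vecI) auto
    with v(2) show False by simp
  qed
  then have N0: "N \<noteq> 0" unfolding N_re by (simp only: of_real_eq_0_iff not_False_eq_True)
  have eq: "(\<Sum>i<n. \<Sum>j<n. cnj (v $ i) * (of_real (A $$ (i,j)) * v $ j)) = z * N" 
    unfolding N_def sum_distrib_left[symmetric] using ev
    by (simp add: sum_distrib_left mult_ac)
  have "cnj (z * N) = (\<Sum>i<n. \<Sum>j<n. v $ i * (of_real (A $$ (i,j)) * cnj (v $ j)))"
    unfolding eq[symmetric] by (simp add: cnj_sum)
  also have "\<dots> = (\<Sum>j<n. \<Sum>i<n. v $ i * (of_real (A $$ (i,j)) * cnj (v $ j)))"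
    by (rule sum.swap)
  also have "\<dots> = z * N"
    unfolding eq[symmetric] by (intro sum.cong refl) (simp add: A_sym mult_ac)
  finally have "cnj z = z" using N0 unfolding N_re by (simp del: of_real_sum)
  then obtain e where e: "z = of_real e" by (metis Reals_cnj_iff Reals_cases)
  have "poly (char_poly A) e = 0"
    using z unfolding e of_real_hom.char_poly_hom[OF A] by simp
  then show ?thesis using eigenvalue_root_char_poly[OF A] by auto
qed

text \<open>The Householder reflection exchanging \<open>v\<close> and the first basis vector: a way to complete
  \<open>v\<close> to an orthonormal basis that also works, as the identity, when the two vectors coincide.\<close>
lemma reflection_to_unit_vector:
  fixes v :: "nat \<Rightarrow> real"
  assumes n: "n > 0" and v: "(\<Sum>i<n. (v i)\<^sup>2) = 1"
  shows "\<exists>W \<in> carrier_mat n n. transpose_mat W = W \<and> W * W = 1\<^sub>m n \<and> col W 0 = vec n v"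
proof -
  define u where "u i = v i - (if i = 0 then 1 else 0)" for i :: nat
  define s where "s = (\<Sum>i<n. (u i)\<^sup>2)"
  (* c = 0 if u = 0, by the convention for division by zero, so that W is the identity then *)
  define c where "c = 2 / s"
  have delta: "(\<Sum>i<n. f i * (if i = 0 then 1 else 0)) = f 0" for f :: "nat \<Rightarrow> real"
    using n by (simp add: sum.delta if_distrib cong: if_cong)
  have "s = (\<Sum>i<n. (v i)\<^sup>2) - 2 * (\<Sum>i<n. v i * (if i = 0 then 1 else 0))
      + (\<Sum>i<n. 1 * (if i = 0 then 1 else 0))"
    unfolding s_def u_def sum_distrib_left sum.distrib[symmetric] sum_subtractf[symmetric]
    by (intro sum.cong refl) (simp add: power2_eq_square algebra_simps)
  then have s: "s = 2 - 2 * v 0" unfolding delta v by simp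
  have cs: "c * c * s = 2 * c" unfolding c_def by simp
  define W where "W = mat n n (\<lambda>(i,j). (if i = j then 1 else 0) - c * u i * u j)"
  have W: "W \<in> carrier_mat n n" unfolding W_def by simp
  have "transpose_mat W = W" unfolding W_def by (rule eq_matI) auto
  moreover have "W * W = 1\<^sub>m n"
  proof (rule eq_matI)
    fix i j assume "i < dim_row (1\<^sub>m n :: real mat)" "j < dim_col (1\<^sub>m n :: real mat)"
    then have ij: "i < n" "j < n" by auto
    have "(W * W) $$ (i,j) = (\<Sum>k<n. ((if i = k then 1 else 0) - c * u i * u k) *
        ((if k = j then 1 else 0) - c * u k * u j))"
      using ij by (simp add: W_def scalar_prod_def lessThan_atLeast0)
    also have "\<dots> = (\<Sum>k<n. (if i = k then (if k = j then 1 else 0) else 0)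
        - (if i = k then c * u k * u j else 0) - (if k = j then c * u i * u k else 0)
        + c * c * u i * u j * (u k)\<^sup>2)"
      by (intro sum.cong refl) (auto simp: power2_eq_square algebra_simps)
    also have "\<dots> = (if i = j then 1 else 0) - 2 * c * u i * u j + (c * c * s) * u i * u j"
      using ij unfolding s_def by (simp add: sum.distrib sum_subtractf sum.delta sum.delta' sum_distrib_left mult_ac)
    also have "\<dots> = 1\<^sub>m n $$ (i,j)" unfolding cs using ij by simp
    finally show "(W * W) $$ (i,j) = 1\<^sub>m n $$ (i,j)" .
  qed (use W in auto)
  moreover have "col W 0 = vec n v"
  proof (rule eq_vecI)
    fix i assume "i < dim_vec (vec n v)"
    then have i: "i < n" by simp
    have "c * u i * u 0 = - u i"
    proof (cases "s = 0")
      case True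
      then have "\<forall>i<n. u i = 0" unfolding s_def by (subst (asm) sum_nonneg_eq_0_iff) auto
      then show ?thesis using i by simp
    next
      case False
      moreover have "u 0 = - s / 2" unfolding s u_def by simp
      ultimately show ?thesis unfolding c_def by simp
    qed
    then show "col W 0 $ i = vec n v $ i" using i n unfolding W_def by (auto simp: u_def)
  qed (use W in auto)
  ultimately show ?thesis using W by blast
qed

text \<open>Induction on the size: reflecting a unit eigenvector to the first basis vector splits off
  a \<open>1 \<times> 1\<close> block, and symmetry makes the off-diagonal blocks vanish.\<close>
theorem real_symmetric_spectral:
  fixes A :: "real mat"
  assumes "A \<in> carrier_mat n n" and "transpose_mat A = A"
  shows "\<exists>U D. U \<in> carrier_mat n n \<and> D \<in> carrier_mat n n \<and> diagonal_mat D \<and>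
    transpose_mat U * U = 1\<^sub>m n \<and> A = U * D * transpose_mat U"
  using assms
proof (induction n arbitrary: A)
  case 0
  then show ?case
    by (intro exI[of _ "1\<^sub>m 0"] exI[of _ A]) (auto simp: diagonal_mat_def)
next
  case (Suc n)
  note A = Suc.prems(1) and sym = Suc.prems(2)
  let ?m = "Suc n"
  obtain e where "eigenvalue A e"
    using real_symmetric_has_real_eigenvalue[OF A sym] by auto
  then obtain x where x: "x \<in> carrier_vec ?m" "x \<noteq> 0\<^sub>v ?m" "A *\<^sub>v x = e \<cdot>\<^sub>v x"
    using A unfolding eigenvalue_def eigenvector_def by auto
  define s where "s = (\<Sum>i<?m. (x $ i)\<^sup>2)"
  have "s > 0"
  proof -
    have "\<exists>i<?m. x $ i \<noteq> 0" using x(1,2) by (metis eq_vecI carrier_vecD index_zero_vec)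
    then show ?thesis unfolding s_def by (metis (no_types, lifting) finite_lessThan lessThan_iff sum_pos2 zero_le_power2 zero_less_power2)
  qed
  define v where "v i = x $ i / sqrt s" for i
  have "(\<Sum>i<?m. (v i)\<^sup>2) = 1"
    using \<open>s > 0\<close> unfolding v_def power_divide sum_divide_distrib[symmetric]
    by (simp add: s_def[symmetric] del: sum.lessThan_Suc)
  from reflection_to_unit_vector[OF zero_less_Suc this]
  obtain W where W: "W \<in> carrier_mat ?m ?m" and WT: "transpose_mat W = W"
    and WW: "W * W = 1\<^sub>m ?m" and W0: "col W 0 = vec ?m v" by blast
  have W0': "col W 0 = (1 / sqrt s) \<cdot>\<^sub>v x"
    unfolding W0 v_def using x(1) by (intro eq_vecI) auto
  define B where "B = W * A * W"
  have B: "B \<in> carrier_mat ?m ?m" unfolding B_def using W A by auto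
  have BT: "transpose_mat B = B"
    unfolding B_def using W A sym WT
    by (simp add: transpose_mult[of _ ?m ?m _ ?m] assoc_mult_mat[of _ ?m ?m _ ?m _ ?m])
  have A_eq: "A = W * B * W"
  proof -
    have "W * B * W = (W * W) * A * (W * W)"
      unfolding B_def using W A by (simp add: assoc_mult_mat[of _ ?m ?m _ ?m _ ?m])
    then show ?thesis using WW A by simp
  qed
  have Bcol: "B $$ (i, 0) = (if i = 0 then e else 0)" if "i < ?m" for i
  proof -
    have "col B 0 = (W * A) *\<^sub>v col W 0" unfolding B_def using W A
      by (intro col_mult2[of _ ?m ?m _ ?m]) auto
    also have "\<dots> = W *\<^sub>v (A *\<^sub>v col W 0)" 
      using W A by (intro assoc_mult_mat_vec[of _ ?m ?m _ ?m]) (auto simp: W0)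
    also have "A *\<^sub>v col W 0 = e \<cdot>\<^sub>v col W 0"
      unfolding W0' using x A mult_mat_vec[OF A x(1)] by (auto simp: smult_smult_assoc mult.commute)
    also have "W *\<^sub>v (e \<cdot>\<^sub>v col W 0) = e \<cdot>\<^sub>v (W *\<^sub>v col W 0)" 
      using W by (intro mult_mat_vec[of _ ?m ?m]) (auto simp: W0)
    also have "W *\<^sub>v col W 0 = col (W * W) 0" 
      using W by (intro col_mult2[of _ ?m ?m _ ?m, symmetric]) auto
    finally have "col B 0 $ i = (e \<cdot>\<^sub>v col (1\<^sub>m ?m) 0) $ i" unfolding WW by simp
    then show ?thesis using that B by auto
  qed
  have Bsym: "B $$ (i,j) = B $$ (j,i)" if "i < ?m" "j < ?m" for i j
    using arg_cong[OF BT, of "\<lambda>M. M $$ (i,j)"] that B by auto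
  define B' where "B' = mat n n (\<lambda>(i,j). B $$ (Suc i, Suc j))"
  have B': "B' \<in> carrier_mat n n" "transpose_mat B' = B'"
    unfolding B'_def using Bsym by (auto intro!: eq_matI)
  define E where "E = mat 1 1 (\<lambda>_. e)"
  have E: "E \<in> carrier_mat 1 1" unfolding E_def by simp
  have Bblock: "B = four_block_mat E (0\<^sub>m 1 n) (0\<^sub>m n 1) B'"
  proof (rule eq_matI)
    fix i j assume "i < dim_row (four_block_mat E (0\<^sub>m 1 n) (0\<^sub>m n 1) B')"
      "j < dim_col (four_block_mat E (0\<^sub>m 1 n) (0\<^sub>m n 1) B')"
    then have ij: "i < ?m" "j < ?m" using E B' by auto
    then show "B $$ (i,j) = four_block_mat E (0\<^sub>m 1 n) (0\<^sub>m n 1) B' $$ (i,j)"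
      using Bcol[of i] Bcol[of j] Bsym[of i j] E B'
      by (auto simp: E_def B'_def)
  qed (use B E B' in auto)
  from Suc.IH[OF B'] obtain U D where U: "U \<in> carrier_mat n n" and D: "D \<in> carrier_mat n n"
    and dD: "diagonal_mat D" and UU: "transpose_mat U * U = 1\<^sub>m n"
    and BU: "B' = U * D * transpose_mat U" by blast
  define V where "V = four_block_mat (1\<^sub>m 1) (0\<^sub>m 1 n) (0\<^sub>m n 1) U"
  define F where "F = four_block_mat E (0\<^sub>m 1 n) (0\<^sub>m n 1) D"
  have V: "V \<in> carrier_mat ?m ?m" and F: "F \<in> carrier_mat ?m ?m"
    unfolding V_def F_def
    using four_block_carrier_mat[OF one_carrier_mat[of 1] U]
      four_block_carrier_mat[OF E D] by simp_all
  have VT: "transpose_mat V = four_block_mat (1\<^sub>m 1) (0\<^sub>m 1 n) (0\<^sub>m n 1) (transpose_mat U)"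
    unfolding V_def using U
    by (subst transpose_four_block_mat[of _ 1 1 _ n _ n]) auto
  have VV: "transpose_mat V * V = 1\<^sub>m ?m"
    unfolding VT unfolding V_def using U
    by (subst mult_four_block_mat[of _ 1 1 _ n _ n _ _ 1 _ n]) (auto simp: UU intro!: eq_matI)
  have VF: "V * F = four_block_mat E (0\<^sub>m 1 n) (0\<^sub>m n 1) (U * D)"
    unfolding V_def F_def using U D E
    by (subst mult_four_block_mat[of _ 1 1 _ n _ n _ _ 1 _ n]) auto
  have VFV: "V * F * transpose_mat V = B"
    unfolding VF VT Bblock BU using U D E
    by (subst mult_four_block_mat[of _ 1 1 _ n _ n _ _ 1 _ n]) auto
  have dF: "diagonal_mat F"
    using dD D E unfolding diagonal_mat_def F_def by (auto simp: E_def)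
  have VTc: "transpose_mat V \<in> carrier_mat ?m ?m" using V by auto
  have T: "transpose_mat (W * V) = transpose_mat V * W"
    using W V WT by (simp add: transpose_mult[of _ ?m ?m _ ?m])
  show ?case
  proof (intro exI conjI)
    show "W * V \<in> carrier_mat ?m ?m" using W V by auto
    show "F \<in> carrier_mat ?m ?m" by (rule F)
    show "diagonal_mat F" by (rule dF)
    have "transpose_mat (W * V) * (W * V) = transpose_mat V * ((W * W) * V)"
      unfolding T using W V VTc by (simp add: assoc_mult_mat[of _ ?m ?m _ ?m _ ?m])
    then show "transpose_mat (W * V) * (W * V) = 1\<^sub>m ?m" using WW VV V by simp
    have "(W * V) * F * transpose_mat (W * V) = W * (V * F * transpose_mat V) * W"
      unfolding T using W V F VTc by (simp add: assoc_mult_mat[of _ ?m ?m _ ?m _ ?m])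
    then show "A = (W * V) * F * transpose_mat (W * V)" by (metis A_eq VFV)
  qed
qed

section \<open>Inertia and the signs of the quadratic form\<close>

lemma eigenvalue_count_of_factorization:
  fixes d :: "nat \<Rightarrow> real"
  assumes A: "A \<in> carrier_mat n n" and cp: "char_poly A = (\<Prod>k<n. [:- complex_of_real (d k), 1:])"
  shows "eigenvalue_count A P = card {k. k < n \<and> P (d k)}"
proof -
  have ev: "eigenvalue A (complex_of_real x) \<longleftrightarrow> x \<in> d ` {..<n}" for x
    unfolding eigenvalue_root_char_poly[OF A] cp poly_prod by auto
  have order: "Polynomial.order (complex_of_real x) (char_poly A) = card {k. k < n \<and> d k = x}" for x
  proof -
    have "Polynomial.order (complex_of_real x) (char_poly A)
        = (\<Sum>k<n. Polynomial.order (complex_of_real x) [:- complex_of_real (d k), 1:])"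
      unfolding cp
    proof (induction n)
      case (Suc m)
      have "(\<Prod>k<m. [:- complex_of_real (d k), 1:]) * [:- complex_of_real (d m), 1:] \<noteq> 0"
        unfolding mult_eq_0_iff by simp
      from Polynomial.order_mult[OF this, of "complex_of_real x"] show ?case
        unfolding prod.lessThan_Suc sum.lessThan_Suc Suc .
    qed simp
    also have "\<dots> = (\<Sum>k<n. if d k = x then 1 else 0)"
      by (intro sum.cong refl) (auto simp: order_linear' order_0I)
    also have "\<dots> = card {k. k < n \<and> d k = x}"
      by (simp add: sum.If_cases Collect_conj_eq Int_commute lessThan_def)
    finally show ?thesis .
  qed
  have "eigenvalue_count A P = (\<Sum>x | x \<in> d ` {..<n} \<and> P x. card {k. k < n \<and> d k = x})"
    unfolding eigenvalue_count_def ev order ..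
  also have "\<dots> = card (\<Union>x\<in>{x \<in> d ` {..<n}. P x}. {k. k < n \<and> d k = x})"
    by (intro card_UN_disjoint[symmetric]) auto
  also have "(\<Union>x\<in>{x \<in> d ` {..<n}. P x}. {k. k < n \<and> d k = x}) = {k. k < n \<and> P (d k)}"
    by auto
  finally show ?thesis .
qed

definition qform :: "nat \<Rightarrow> (nat \<Rightarrow> nat \<Rightarrow> real) \<Rightarrow> (nat \<Rightarrow> real) \<Rightarrow> real" where
  "qform n G v = (\<Sum>i<n. v i * (\<Sum>j<n. G i j * v j))"

definition symmetric_on :: "nat \<Rightarrow> (nat \<Rightarrow> nat \<Rightarrow> real) \<Rightarrow> bool" where
  "symmetric_on n G \<longleftrightarrow> (\<forall>i<n. \<forall>j<n. G i j = G j i)"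

text \<open>For real symmetric \<open>G\<close>, given by its entries, so that submatrices and parametrised families
  need no change of carrier. The three components of the inertia are instances of \<open>P\<close>.\<close>
definition eig_count :: "nat \<Rightarrow> (nat \<Rightarrow> nat \<Rightarrow> real) \<Rightarrow> (real \<Rightarrow> bool) \<Rightarrow> nat" where
  "eig_count n G P = eigenvalue_count (map_mat complex_of_real (mat n n (\<lambda>(i, j). G i j))) P"

text \<open>All that is needed later of the orthonormal eigenvectors \<open>w k\<close> with eigenvalues \<open>d k\<close>:
  in the coordinates \<open>\<Sum>\<^sub>j w k j * v j\<close> the squared norm of \<open>G v\<close>, the quadratic form and
  the norm are diagonal.\<close>
lemma spectral_coordinates:
  assumes sym: "symmetric_on n G"
  shows "\<exists>(d :: nat \<Rightarrow> real) (w :: nat \<Rightarrow> nat \<Rightarrow> real).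
    (\<forall>v. (\<Sum>i<n. (\<Sum>j<n. G i j * v j)\<^sup>2) = (\<Sum>k<n. (d k)\<^sup>2 * (\<Sum>j<n. w k j * v j)\<^sup>2)) \<and>
    (\<forall>v. qform n G v = (\<Sum>k<n. d k * (\<Sum>j<n. w k j * v j)\<^sup>2)) \<and>
    (\<forall>v. (\<Sum>i<n. (v i)\<^sup>2) = (\<Sum>k<n. (\<Sum>j<n. w k j * v j)\<^sup>2)) \<and>
    (\<forall>P. eig_count n G P = card {k. k < n \<and> P (d k)})"
proof -
  interpret of_real_poly: map_poly_comm_ring_hom complex_of_real ..
  define A where "A = mat n n (\<lambda>(i, j). G i j)"
  have A: "A \<in> carrier_mat n n" and "transpose_mat A = A"
    unfolding A_def using sym by (auto simp: symmetric_on_def)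
  from real_symmetric_spectral[OF this]
  obtain U D where U: "U \<in> carrier_mat n n" and D: "D \<in> carrier_mat n n" and dD: "diagonal_mat D"
    and UU: "transpose_mat U * U = 1\<^sub>m n" and AU: "A = U * D * transpose_mat U" by blast
  have UT: "transpose_mat U \<in> carrier_mat n n" using U by auto
  have UU': "U * transpose_mat U = 1\<^sub>m n"
    using mat_mult_left_right_inverse[OF UT U UU] .
  define d where "d k = D $$ (k, k)" for k
  define w where "w k i = U $$ (i, k)" for k i
  have Dd: "D = mat n n (\<lambda>(i, j). if i = j then d i else 0)"
    using D dD unfolding diagonal_mat_def d_def by (intro eq_matI) auto
  have G_eq: "G i j = (\<Sum>k<n. d k * w k i * w k j)" if "i < n" "j < n" for i j
  proof -
    have UD: "(U * D) $$ (i, k) = w k i * d k" if "k < n" for k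
      using that \<open>i < n\<close> U unfolding Dd w_def
      by (simp add: scalar_prod_def if_distrib sum.delta cong: if_cong)
    define X where "X = U * D"
    have X: "X \<in> carrier_mat n n" "A = X * transpose_mat U" unfolding X_def AU using U D by auto
    have "A $$ (i, j) = (\<Sum>k<n. X $$ (i, k) * w k j)"
      unfolding X(2) using that U X(1) UT by (simp add: scalar_prod_def lessThan_atLeast0 w_def)
    then have "A $$ (i, j) = (\<Sum>k<n. (U * D) $$ (i, k) * w k j)" unfolding X_def .
    then show ?thesis using that by (simp add: UD A_def mult_ac)
  qed
  have W1: "(\<Sum>k<n. w k i * w k j) = (if i = j then 1 else 0)" if "i < n" "j < n" for i j
    using arg_cong[OF UU', of "\<lambda>M. M $$ (i,j)"] that U
    by (simp add: scalar_prod_def lessThan_atLeast0 w_def)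
  have 1: "(\<Sum>j<n. G i j * v j) = (\<Sum>k<n. d k * (\<Sum>j<n. w k j * v j) * w k i)" if "i < n" for i v
  proof -
    have "(\<Sum>j<n. G i j * v j) = (\<Sum>j<n. \<Sum>k<n. d k * w k i * w k j * v j)"
      using that by (simp add: G_eq sum_distrib_right)
    also have "\<dots> = (\<Sum>k<n. \<Sum>j<n. d k * w k i * w k j * v j)" by (rule sum.swap)
    finally show ?thesis by (simp add: sum_distrib_left sum_distrib_right mult_ac)
  qed
  have 2: "qform n G v = (\<Sum>k<n. d k * (\<Sum>j<n. w k j * v j)\<^sup>2)" for v
  proof -
    have "qform n G v = (\<Sum>i<n. \<Sum>k<n. v i * (d k * (\<Sum>j<n. w k j * v j) * w k i))"
      unfolding qform_def by (simp add: 1 sum_distrib_left)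
    also have "\<dots> = (\<Sum>k<n. \<Sum>i<n. v i * (d k * (\<Sum>j<n. w k j * v j) * w k i))" by (rule sum.swap)
    also have "\<dots> = (\<Sum>k<n. d k * (\<Sum>j<n. w k j * v j) * (\<Sum>i<n. w k i * v i))"
      unfolding sum_distrib_left by (intro sum.cong refl) (simp add: mult_ac)
    finally show ?thesis by (simp add: power2_eq_square mult.assoc)
  qed
  have W2: "(\<Sum>i<n. w k i * w l i) = (if k = l then 1 else 0)" if "k < n" "l < n" for k l
    using arg_cong[OF UU, of "\<lambda>M. M $$ (k,l)"] that U
    by (simp add: scalar_prod_def lessThan_atLeast0 w_def)
  have parseval: "(\<Sum>i<n. (\<Sum>k<n. a k i * x k)\<^sup>2) = (\<Sum>k<n. (x k)\<^sup>2)"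
    if orth: "\<And>k l. k < n \<Longrightarrow> l < n \<Longrightarrow> (\<Sum>i<n. a k i * a l i) = (if k = l then 1 else 0)"
    for a :: "nat \<Rightarrow> nat \<Rightarrow> real" and x
  proof -
    have comm: "(a k i * x k) * (a l i * x l) = a k i * a l i * (x k * x l)" for k l i
      by (simp add: mult_ac)
    have "(\<Sum>i<n. (\<Sum>k<n. a k i * x k)\<^sup>2) = (\<Sum>i<n. \<Sum>k<n. \<Sum>l<n. a k i * a l i * (x k * x l))"
      unfolding power2_eq_square sum_product comm ..
    also have "\<dots> = (\<Sum>k<n. \<Sum>i<n. \<Sum>l<n. a k i * a l i * (x k * x l))" by (rule sum.swap)
    also have "\<dots> = (\<Sum>k<n. \<Sum>l<n. \<Sum>i<n. a k i * a l i * (x k * x l))"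
      by (rule sum.cong[OF refl], rule sum.swap)
    also have "\<dots> = (\<Sum>k<n. \<Sum>l<n. if k = l then x k * x l else 0)"
      by (intro sum.cong refl) (auto simp: orth sum_distrib_right[symmetric])
    also have "\<dots> = (\<Sum>k<n. (x k)\<^sup>2)" by (simp add: power2_eq_square)
    finally show ?thesis .
  qed
  have 3: "(\<Sum>i<n. (v i)\<^sup>2) = (\<Sum>k<n. (\<Sum>j<n. w k j * v j)\<^sup>2)" for v
    using parseval[of "\<lambda>i k. w k i" v] W1 by simp
  have 0: "(\<Sum>i<n. (\<Sum>j<n. G i j * v j)\<^sup>2) = (\<Sum>k<n. (d k)\<^sup>2 * (\<Sum>j<n. w k j * v j)\<^sup>2)" for v
    using parseval[of w "\<lambda>k. d k * (\<Sum>j<n. w k j * v j)"] W2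
    by (simp add: 1 power_mult_distrib mult.commute[of "w _ _" "d _ * _"])
  have "similar_mat_wit A D U (transpose_mat U)"
    by (rule similar_mat_witI[of _ _ n]) (use UU UU' AU A D U UT in auto)
  then have "char_poly A = char_poly D"
    by (intro char_poly_similar) (auto simp: similar_mat_def)
  also have "\<dots> = (\<Prod>a\<leftarrow>diag_mat D. [:- a, 1:])"
    by (rule char_poly_upper_triangular[OF D]) (simp add: Dd upper_triangular_def)
  also have "\<dots> = (\<Prod>k<n. [:- d k, 1:])"
    using D unfolding diag_mat_def d_def
    by (simp add: o_def prod.list_conv_set_nth lessThan_atLeast0)
  finally have "char_poly (map_mat complex_of_real A) = (\<Prod>k<n. [:- complex_of_real (d k), 1:])"
    unfolding of_real_hom.char_poly_hom[OF A]
    by (simp add: of_real_poly.hom_prod)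
  from eigenvalue_count_of_factorization[OF _ this]
  have "eig_count n G P = card {k. k < n \<and> P (d k)}" for P
    unfolding eig_count_def using A by (simp add: A_def)
  with 0 2 3 show ?thesis by blast
qed

text \<open>Pad the coefficient matrix with zero rows to a square matrix, whose determinant vanishes.\<close>
lemma underdetermined_system_nontrivial_solution:
  fixes f :: "'a \<Rightarrow> nat \<Rightarrow> real"
  assumes S: "finite S" "card S < n"
  obtains v where "\<And>s. s \<in> S \<Longrightarrow> (\<Sum>j<n. f s j * v j) = 0" "\<exists>j<n. v j \<noteq> 0"
proof -
  obtain g where g: "bij_betw g {..<card S} S"
    using ex_bij_betw_nat_finite[OF S(1)] by (auto simp: lessThan_atLeast0)
  define M where "M = mat n n (\<lambda>(i, j). if i < card S then f (g i) j else 0)"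
  have M: "M \<in> carrier_mat n n" unfolding M_def by simp
  have "M = mat\<^sub>r n n (\<lambda>i. if i = card S then 0\<^sub>v n else row M i)"
    by (rule eq_matI) (auto simp: M_def)
  then have "det M = 0"
    using det_row_0[OF S(2), of "row M"] M by simp
  then obtain x where x: "x \<in> carrier_vec n" "x \<noteq> 0\<^sub>v n" "M *\<^sub>v x = 0\<^sub>v n"
    using det_0_iff_vec_prod_zero[OF M] by auto
  show thesis
  proof (rule that[of "\<lambda>j. x $ j"])
    fix s assume "s \<in> S"
    then obtain i where i: "i < card S" "s = g i" using g by (auto simp: bij_betw_def)
    then have "(M *\<^sub>v x) $ i = (\<Sum>j<n. f s j * x $ j)"
      using S(2) x(1) by (simp add: M_def scalar_prod_def lessThan_atLeast0)
    then show "(\<Sum>j<n. f s j * x $ j) = 0" using x(3) i S(2) by simp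
  next
    show "\<exists>j<n. x $ j \<noteq> 0" using x(1,2) by (metis eq_vecI carrier_vecD index_zero_vec)
  qed
qed

abbreviation num_zero :: "nat \<Rightarrow> (nat \<Rightarrow> nat \<Rightarrow> real) \<Rightarrow> nat" where
  "num_zero n G \<equiv> eig_count n G (\<lambda>x. x = 0)"
text \<open>For \<open>\<sigma> = 1\<close> the number of positive, for \<open>\<sigma> = -1\<close> of negative eigenvalues. Carrying
  the sign as a parameter avoids duplicating each argument, since below the relevant sign is \<open>(-1)\<^sup>M\<close>.\<close>
abbreviation num_sign :: "nat \<Rightarrow> (nat \<Rightarrow> nat \<Rightarrow> real) \<Rightarrow> real \<Rightarrow> nat" where
  "num_sign n G \<sigma> \<equiv> eig_count n G (\<lambda>x. 0 < \<sigma> * x)"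

lemma signature_total:
  assumes sym: "symmetric_on n G" and \<sigma>: "\<sigma> \<noteq> 0"
  shows "num_sign n G \<sigma> + num_zero n G + num_sign n G (- \<sigma>) = n"
proof -
  obtain d :: "nat \<Rightarrow> real" where d: "\<And>P. eig_count n G P = card {k. k < n \<and> P (d k)}"
    using spectral_coordinates[OF sym] by blast
  have "card {k. k < n \<and> 0 < \<sigma> * d k} + card {k. k < n \<and> d k = 0} + card {k. k < n \<and> 0 < - \<sigma> * d k}
      = card ({k. k < n \<and> 0 < \<sigma> * d k} \<union> {k. k < n \<and> d k = 0} \<union> {k. k < n \<and> 0 < - \<sigma> * d k})"
    by (subst card_Un_disjoint, (auto)[3])+ simp
  also have "{k. k < n \<and> 0 < \<sigma> * d k} \<union> {k. k < n \<and> d k = 0} \<union> {k. k < n \<and> 0 < - \<sigma> * d k} = {..<n}"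
    using \<sigma> by (auto simp: not_less zero_less_mult_iff mult_less_0_iff)
  finally show ?thesis unfolding d by simp
qed

text \<open>Were there fewer than \<open>n - card S\<close> eigenvalues of sign \<open>\<sigma>\<close>, the equations \<open>S\<close> and the vanishing
  of the coordinates along their eigenvectors would have a common nonzero solution, on which the form would
  have both signs.\<close>
lemma definite_on_codim:
  assumes sym: "symmetric_on n G" and S: "finite S"
    and def: "\<And>v. (\<And>s. s \<in> S \<Longrightarrow> (\<Sum>j<n. f s j * v j) = 0) \<Longrightarrow> \<exists>j<n. v j \<noteq> 0 \<Longrightarrow> 0 < \<sigma> * qform n G v"
  shows "n \<le> num_sign n G \<sigma> + card S"
proof (rule ccontr)
  assume less: "\<not> n \<le> num_sign n G \<sigma> + card S"
  obtain d w where
    Q: "\<And>v. qform n G v = (\<Sum>k<n. d k * (\<Sum>j<n. w k j * v j)\<^sup>2)" and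
    I: "\<And>P. eig_count n G P = card {k. k < n \<and> P (d k)}"
    using spectral_coordinates[OF sym] by blast
  let ?T = "{k. k < n \<and> 0 < \<sigma> * d k}"
  have "card (S <+> ?T) < n" using less S by (simp add: I card_Plus)
  then obtain v where v: "\<And>s. s \<in> S <+> ?T \<Longrightarrow> (\<Sum>j<n. case_sum f w s j * v j) = 0" "\<exists>j<n. v j \<noteq> 0"
    using underdetermined_system_nontrivial_solution[of "S <+> ?T" n "case_sum f w"] S by auto
  have "0 < \<sigma> * qform n G v" using v(2) v(1)[OF InlI] by (intro def) auto
  moreover have "\<sigma> * (d k * (\<Sum>j<n. w k j * v j)\<^sup>2) \<le> 0" if "k < n" for k
  proof (cases "0 < \<sigma> * d k")
    case True
    then show ?thesis using v(1)[OF InrI, of k] that by simp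
  next
    case False
    then show ?thesis unfolding mult.assoc[symmetric] by (intro mult_nonpos_nonneg[OF _ zero_le_power2]) auto
  qed
  then have "\<sigma> * qform n G v \<le> 0" unfolding Q sum_distrib_left by (intro sum_nonpos) auto
  ultimately show False by simp
qed

text \<open>The analogue of the previous bound for the multiplicity of the eigenvalue \<open>0\<close>: a kernel vector has
  coordinates only along eigenvectors of eigenvalue \<open>0\<close>.\<close>
lemma kernel_on_codim:
  assumes sym: "symmetric_on n G" and S: "finite S"
    and ker: "\<And>v i. (\<And>s. s \<in> S \<Longrightarrow> (\<Sum>j<n. f s j * v j) = 0) \<Longrightarrow> i < n \<Longrightarrow> (\<Sum>j<n. G i j * v j) = 0"
  shows "n \<le> num_zero n G + card S"
proof (rule ccontr)
  assume less: "\<not> n \<le> num_zero n G + card S"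
  obtain d w where
    K: "\<And>v. (\<Sum>i<n. (\<Sum>j<n. G i j * v j)\<^sup>2) = (\<Sum>k<n. (d k)\<^sup>2 * (\<Sum>j<n. w k j * v j)\<^sup>2)" and
    N: "\<And>v. (\<Sum>i<n. (v i)\<^sup>2) = (\<Sum>k<n. (\<Sum>j<n. w k j * v j)\<^sup>2)" and
    I: "\<And>P. eig_count n G P = card {k. k < n \<and> P (d k)}"
    using spectral_coordinates[OF sym] by blast
  let ?T = "{k. k < n \<and> d k = 0}"
  have "card (S <+> ?T) < n" using less S by (simp add: I card_Plus)
  then obtain v where v: "\<And>s. s \<in> S <+> ?T \<Longrightarrow> (\<Sum>j<n. case_sum f w s j * v j) = 0" "\<exists>j<n. v j \<noteq> 0"
    using underdetermined_system_nontrivial_solution[of "S <+> ?T" n "case_sum f w"] S by auto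
  have "(\<Sum>j<n. G i j * v j) = 0" if "i < n" for i using v(1)[OF InlI] that by (intro ker) auto
  then have "(\<Sum>k<n. (d k)\<^sup>2 * (\<Sum>j<n. w k j * v j)\<^sup>2) = 0" unfolding K[symmetric] by simp
  then have "\<forall>k<n. (d k)\<^sup>2 * (\<Sum>j<n. w k j * v j)\<^sup>2 = 0" by (subst (asm) sum_nonneg_eq_0_iff) auto
  then have "\<forall>k<n. (\<Sum>j<n. w k j * v j) = 0" using v(1)[OF InrI] by fastforce
  then have "(\<Sum>i<n. (v i)\<^sup>2) = 0" using N[of v] by simp
  then have "\<forall>i<n. (v i)\<^sup>2 = 0" by (subst (asm) sum_nonneg_eq_0_iff) auto
  then show False using v(2) by auto
qed

text \<open>If some eigenvalue were \<open>0\<close>, a nonzero vector orthogonal to all the other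
  eigenvectors would be in the kernel.\<close>
lemma num_zero_eq_0_if_kernel_trivial:
  assumes sym: "symmetric_on n G"
    and ker: "\<And>v. (\<And>i. i < n \<Longrightarrow> (\<Sum>j<n. G i j * v j) = 0) \<Longrightarrow> \<forall>j<n. v j = 0"
  shows "num_zero n G = 0"
proof -
  obtain d w where
    K: "\<And>v. (\<Sum>i<n. (\<Sum>j<n. G i j * v j)\<^sup>2) = (\<Sum>k<n. (d k)\<^sup>2 * (\<Sum>j<n. w k j * v j)\<^sup>2)" and
    I: "\<And>P. eig_count n G P = card {k. k < n \<and> P (d k)}"
    using spectral_coordinates[OF sym] by blast
  have "{k. k < n \<and> d k = 0} = {}"
  proof (rule ccontr)
    assume "{k. k < n \<and> d k = 0} \<noteq> {}"
    then obtain k0 where k0: "k0 < n" "d k0 = 0" by auto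
    then have "card ({..<n} - {k0}) < n" by (simp add: card_Diff_singleton)
    then obtain v where v: "\<And>k. k \<in> {..<n} - {k0} \<Longrightarrow> (\<Sum>j<n. w k j * v j) = 0" "\<exists>j<n. v j \<noteq> 0"
      using underdetermined_system_nontrivial_solution[of "{..<n} - {k0}" n w] by blast
    have "(d k)\<^sup>2 * (\<Sum>j<n. w k j * v j)\<^sup>2 = 0" if "k < n" for k
      using v(1)[of k] k0 that by (cases "k = k0") auto
    then have "(\<Sum>i<n. (\<Sum>j<n. G i j * v j)\<^sup>2) = 0" unfolding K by (intro sum.neutral) auto
    then have "\<forall>i<n. (\<Sum>j<n. G i j * v j)\<^sup>2 = 0" by (subst (asm) sum_nonneg_eq_0_iff) auto
    then show False using ker[of v] v(2) by auto
  qed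
  then show ?thesis unfolding I by simp
qed

text \<open>The converse of \<open>definite_on_codim\<close>, with a uniform constant: the equations say that the coordinates
  along all eigenvectors with \<open>\<sigma> d\<^sub>k \<le> 0\<close> vanish, and \<open>m\<close> bounds the remaining \<open>\<sigma> d\<^sub>k\<close> below. The constant is
  what makes the bound stable under perturbation of \<open>G\<close>.\<close>
lemma coercive_on_codim:
  assumes sym: "symmetric_on n G"
  shows "\<exists>(T :: nat set) w m. finite T \<and> card T + num_sign n G \<sigma> = n \<and> 0 < m \<and>
    (\<forall>v. (\<forall>k\<in>T. (\<Sum>j<n. w k j * v j) = 0) \<longrightarrow> m * (\<Sum>i<n. (v i)\<^sup>2) \<le> \<sigma> * qform n G v)"
proof -
  obtain d w where
    Q: "\<And>v. qform n G v = (\<Sum>k<n. d k * (\<Sum>j<n. w k j * v j)\<^sup>2)" and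
    N: "\<And>v. (\<Sum>i<n. (v i)\<^sup>2) = (\<Sum>k<n. (\<Sum>j<n. w k j * v j)\<^sup>2)" and
    I: "\<And>P. eig_count n G P = card {k. k < n \<and> P (d k)}"
    using spectral_coordinates[OF sym] by blast
  define R where "R = {k. k < n \<and> 0 < \<sigma> * d k}"
  define m where "m = Min (insert 1 ((\<lambda>k. \<sigma> * d k) ` R))"
  have R: "finite R" "R \<subseteq> {..<n}" unfolding R_def by auto
  have "m > 0" unfolding m_def using R by (subst Min_gr_iff) (auto simp: R_def)
  moreover have m_le: "m \<le> \<sigma> * d k" if "k \<in> R" for k
    unfolding m_def using that R by (intro Min_le) auto
  have "m * (\<Sum>i<n. (v i)\<^sup>2) \<le> \<sigma> * qform n G v"
    if v: "\<forall>k\<in>{..<n} - R. (\<Sum>j<n. w k j * v j) = 0" for v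
    unfolding N[of v] Q sum_distrib_left
  proof (rule sum_mono)
    fix k assume "k \<in> {..<n}"
    then show "m * (\<Sum>j<n. w k j * v j)\<^sup>2 \<le> \<sigma> * (d k * (\<Sum>j<n. w k j * v j)\<^sup>2)"
      using v m_le[of k] unfolding mult.assoc[symmetric]
      by (cases "k \<in> R") (auto intro: mult_right_mono)
  qed
  moreover have "card ({..<n} - R) + num_sign n G \<sigma> = n"
    using R card_mono[of "{..<n}" R] unfolding I R_def[symmetric] by (simp add: card_Diff_subset)
  ultimately show ?thesis by (intro exI[of _ "{..<n} - R"] exI[of _ w] exI[of _ m]) auto
qed

lemma sum_squares_pos:
  fixes v :: "nat \<Rightarrow> real"
  assumes "\<exists>j<n. v j \<noteq> 0"
  shows "0 < (\<Sum>i<n. (v i)\<^sup>2)"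
  using assms by (auto intro: sum_pos2)

lemma positive_definite_if_num_sign_full:
  assumes sym: "symmetric_on n G" and full: "num_sign n G 1 = n" and v: "\<exists>j<n. v j \<noteq> 0"
  shows "0 < qform n G v"
proof -
  obtain T :: "nat set" and w m where T: "finite T" "card T + num_sign n G 1 = n" "0 < m" and
    ge: "\<And>v. (\<forall>k\<in>T. (\<Sum>j<n. w k j * v j) = 0) \<Longrightarrow> m * (\<Sum>i<n. (v i)\<^sup>2) \<le> 1 * qform n G v"
    using coercive_on_codim[OF sym, of 1] by blast
  have "T = {}" using T full by simp
  then have "m * (\<Sum>i<n. (v i)\<^sup>2) \<le> qform n G v" using ge[of v] by simp
  then show ?thesis using mult_pos_pos[OF T(3) sum_squares_pos[OF v]] by linarith
qed

lemma qform_perturbation: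
  assumes "\<And>i j. i < n \<Longrightarrow> j < n \<Longrightarrow> \<bar>H i j - G i j\<bar> \<le> \<epsilon>"
  shows "\<bar>qform n H v - qform n G v\<bar> \<le> \<epsilon> * real n * (\<Sum>i<n. (v i)\<^sup>2)"
proof -
  have "qform n H v - qform n G v = (\<Sum>i<n. \<Sum>j<n. (H i j - G i j) * (v i * v j))"
    unfolding qform_def sum_subtractf[symmetric] sum_distrib_left
    by (intro sum.cong refl) (simp add: algebra_simps)
  also have "\<bar>\<dots>\<bar> \<le> (\<Sum>i<n. \<Sum>j<n. \<epsilon> * (((v i)\<^sup>2 + (v j)\<^sup>2) / 2))"
  proof (intro order_trans[OF sum_abs] sum_mono)
    fix i j assume "i \<in> {..<n}" "j \<in> {..<n}"
    moreover have "\<bar>v i * v j\<bar> \<le> ((v i)\<^sup>2 + (v j)\<^sup>2) / 2"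
      using sum_squares_bound[of "\<bar>v i\<bar>" "\<bar>v j\<bar>"] by (simp add: abs_mult)
    ultimately show "\<bar>(H i j - G i j) * (v i * v j)\<bar> \<le> \<epsilon> * (((v i)\<^sup>2 + (v j)\<^sup>2) / 2)"
      unfolding abs_mult[of "H i j - G i j"] using assms[of i j] by (intro mult_mono) auto
  qed
  also have "\<dots> = \<epsilon> * real n * (\<Sum>i<n. (v i)\<^sup>2)"
    by (simp add: sum_distrib_left[symmetric] sum.distrib sum_divide_distrib[symmetric] add_divide_distrib algebra_simps)
  finally show ?thesis .
qed

lemma num_sign_lower_semicontinuous:
  assumes sym: "symmetric_on n G" and \<sigma>: "\<sigma> \<noteq> 0"
  shows "\<exists>\<epsilon>>0. \<forall>H. symmetric_on n H \<longrightarrow> (\<forall>i<n. \<forall>j<n. \<bar>H i j - G i j\<bar> < \<epsilon>) \<longrightarrow>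
    num_sign n G \<sigma> \<le> num_sign n H \<sigma>"
proof -
  obtain T :: "nat set" and w m where T: "finite T" "card T + num_sign n G \<sigma> = n" "0 < m" and
    ge: "\<And>v. (\<forall>k\<in>T. (\<Sum>j<n. w k j * v j) = 0) \<Longrightarrow> m * (\<Sum>i<n. (v i)\<^sup>2) \<le> \<sigma> * qform n G v"
    using coercive_on_codim[OF sym, of \<sigma>] by blast
  define \<epsilon> where "\<epsilon> = m / (\<bar>\<sigma>\<bar> * real (Suc n))"
  have eps: "\<epsilon> > 0" "\<bar>\<sigma>\<bar> * (\<epsilon> * real n) < m"
  proof -
    show "\<epsilon> > 0" using T(3) \<sigma> unfolding \<epsilon>_def by simp
    have "\<bar>\<sigma>\<bar> * (\<epsilon> * real n) = m * (real n / real (Suc n))" using \<sigma> unfolding \<epsilon>_def by simp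
    also have "\<dots> < m * 1" using T(3) by (intro mult_strict_left_mono) auto
    finally show "\<bar>\<sigma>\<bar> * (\<epsilon> * real n) < m" by simp
  qed
  have "num_sign n G \<sigma> \<le> num_sign n H \<sigma>"
    if H: "symmetric_on n H" "\<forall>i<n. \<forall>j<n. \<bar>H i j - G i j\<bar> < \<epsilon>" for H
  proof -
    have "n \<le> num_sign n H \<sigma> + card T"
    proof (rule definite_on_codim[OF H(1) T(1), of w])
      fix v assume v: "\<And>k. k \<in> T \<Longrightarrow> (\<Sum>j<n. w k j * v j) = 0" and v0: "\<exists>j<n. v j \<noteq> 0"
      define N2 where "N2 = (\<Sum>i<n. (v i)\<^sup>2)"
      have "N2 > 0" unfolding N2_def using v0 by (rule sum_squares_pos)
      have "m * N2 \<le> \<sigma> * qform n G v" unfolding N2_def using v by (intro ge) auto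
      moreover have "\<bar>\<sigma> * (qform n H v - qform n G v)\<bar> \<le> \<bar>\<sigma>\<bar> * (\<epsilon> * real n) * N2"
        unfolding N2_def abs_mult mult.assoc[of "\<bar>\<sigma>\<bar>"]
        using H(2) by (intro mult_left_mono qform_perturbation) (auto simp: less_imp_le)
      moreover have "\<bar>\<sigma>\<bar> * (\<epsilon> * real n) * N2 < m * N2" using eps(2) \<open>N2 > 0\<close> by simp
      moreover have "\<sigma> * qform n H v = \<sigma> * qform n G v + \<sigma> * (qform n H v - qform n G v)"
        by (simp add: algebra_simps)
      ultimately show "0 < \<sigma> * qform n H v" by linarith
    qed
    then show ?thesis using T(2) by simp
  qed
  then show ?thesis using eps(1) by blast
qed

text \<open>Both sign counts can only jump up near a point, and their sum stays \<open>n\<close>, so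
  they are locally constant.\<close>
lemma signature_const_on_connected:
  fixes G :: "real \<Rightarrow> nat \<Rightarrow> nat \<Rightarrow> real"
  assumes conn: "connected X" and sym: "\<And>t. symmetric_on n (G t)"
    and cont: "\<And>i j. i < n \<Longrightarrow> j < n \<Longrightarrow> continuous_on X (\<lambda>t. G t i j)"
    and nz: "\<And>t. t \<in> X \<Longrightarrow> num_zero n (G t) = 0"
    and a: "a \<in> X" and b: "b \<in> X"
  shows "num_sign n (G a) 1 = num_sign n (G b) 1 \<and> num_sign n (G a) (-1) = num_sign n (G b) (-1)"
proof -
  define F where "F t = (num_sign n (G t) 1, num_sign n (G t) (-1))" for t
  have "F a = F b"
  proof (rule connected_local_const[OF conn a b], rule ballI)
    fix t assume t: "t \<in> X"
    have near: "\<forall>\<^sub>F s in at t within X. num_sign n (G t) \<sigma> \<le> num_sign n (G s) \<sigma>"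
      if \<sigma>: "\<sigma> \<noteq> 0" for \<sigma>
    proof -
      from num_sign_lower_semicontinuous[OF sym \<sigma>] obtain \<epsilon> where \<epsilon>: "\<epsilon> > 0"
        and st: "\<And>H. symmetric_on n H \<Longrightarrow> (\<forall>i<n. \<forall>j<n. \<bar>H i j - G t i j\<bar> < \<epsilon>) \<Longrightarrow>
          num_sign n (G t) \<sigma> \<le> num_sign n H \<sigma>" by blast
      have "\<forall>\<^sub>F s in at t within X. \<forall>i\<in>{..<n}. \<forall>j\<in>{..<n}. \<bar>G s i j - G t i j\<bar> < \<epsilon>"
      proof (intro eventually_ball_finite finite_lessThan ballI)
        fix i j assume "i \<in> {..<n}" "j \<in> {..<n}"
        then have "((\<lambda>s. G s i j) \<longlongrightarrow> G t i j) (at t within X)"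
          using cont[of i j] t by (auto simp: continuous_on_def)
        from tendstoD[OF this \<epsilon>] show "\<forall>\<^sub>F s in at t within X. \<bar>G s i j - G t i j\<bar> < \<epsilon>"
          by (simp add: dist_real_def)
      qed
      then show ?thesis by (rule eventually_mono) (use st[OF sym] in auto)
    qed
    have total: "num_sign n (G s) 1 + num_sign n (G s) (-1) = n" if "s \<in> X" for s
      using signature_total[OF sym, of 1 s] nz[OF that] by simp
    have "\<forall>\<^sub>F s in at t within X. s \<in> X" by (simp add: eventually_at_filter)
    moreover have "\<forall>\<^sub>F s in at t within X. num_sign n (G t) 1 \<le> num_sign n (G s) 1"
      and "\<forall>\<^sub>F s in at t within X. num_sign n (G t) (-1) \<le> num_sign n (G s) (-1)"
      by (intro near; simp)+
    ultimately show "\<forall>\<^sub>F s in at t within X. F t = F s"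
    proof eventually_elim
      case (elim s)
      then show ?case using total[OF t] total[OF elim(1)] unfolding F_def prod.inject by linarith
    qed
  qed
  then show ?thesis unfolding F_def by simp
qed

lemma qform_submatrix:
  assumes "m \<le> n" and "\<And>j. m \<le> j \<Longrightarrow> j < n \<Longrightarrow> v j = 0"
  shows "qform n G v = qform m G v"
proof -
  have inner: "(\<Sum>j<n. G i j * v j) = (\<Sum>j<m. G i j * v j)" for i
    using assms by (intro sum.mono_neutral_right) auto
  show ?thesis unfolding qform_def inner
    using assms by (intro sum.mono_neutral_right) auto
qed

lemma symmetric_on_subset: "symmetric_on n G \<Longrightarrow> m \<le> n \<Longrightarrow> symmetric_on m G"
  unfolding symmetric_on_def by auto

text \<open>One half of Cauchy interlacing: extend vectors by zero. With the next lemma, deleting \<open>n - m\<close>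
  rows and columns loses at most \<open>n - m\<close> eigenvalues of either sign.\<close>
lemma num_sign_submatrix_le:
  assumes sym: "symmetric_on n G" and mn: "m \<le> n"
  shows "num_sign m G \<sigma> \<le> num_sign n G \<sigma>"
proof -
  obtain T :: "nat set" and w c where T: "finite T" "card T + num_sign m G \<sigma> = m" "0 < c" and
    ge: "\<And>v. (\<forall>k\<in>T. (\<Sum>j<m. w k j * v j) = 0) \<Longrightarrow> c * (\<Sum>i<m. (v i)\<^sup>2) \<le> \<sigma> * qform m G v"
    using coercive_on_codim[OF symmetric_on_subset[OF sym mn], of \<sigma>] by blast
  define f where "f = case_sum (\<lambda>k j. if j < m then w k j else 0) (\<lambda>k j :: nat. if j = k then 1 else (0::real))"
  have "n \<le> num_sign n G \<sigma> + card (T <+> {m..<n})"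
  proof (rule definite_on_codim[OF sym, of _ f])
    fix v assume v: "\<And>s. s \<in> T <+> {m..<n} \<Longrightarrow> (\<Sum>j<n. f s j * v j) = 0" and v0: "\<exists>j<n. v j \<noteq> 0"
    have z: "v k = 0" if "m \<le> k" "k < n" for k
      using v[OF InrI, of k] that by (simp add: f_def if_distrib[of "\<lambda>x. x * _"] sum.delta cong: if_cong)
    have "(\<Sum>j<m. w k j * v j) = 0" if "k \<in> T" for k
    proof -
      have "(\<Sum>j<n. f (Inl k) j * v j) = (\<Sum>j<m. f (Inl k) j * v j)"
        using z mn by (intro sum.mono_neutral_right) auto
      then show ?thesis using v[OF InlI[OF that]] by (simp add: f_def)
    qed
    then have "c * (\<Sum>i<m. (v i)\<^sup>2) \<le> \<sigma> * qform m G v" by (intro ge) auto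
    moreover have "\<exists>j<m. v j \<noteq> 0" using v0 z by (meson not_less)
    ultimately have "0 < \<sigma> * qform m G v"
      using mult_pos_pos[OF T(3) sum_squares_pos[of m v]] by (meson less_le_trans)
    then show "0 < \<sigma> * qform n G v" using qform_submatrix[OF mn, of v G] z by simp
  qed (use T in simp)
  then show ?thesis using T mn by (simp add: card_Plus)
qed

lemma num_sign_le_submatrix:
  assumes sym: "symmetric_on n G" and mn: "m \<le> n"
  shows "num_sign n G \<sigma> \<le> num_sign m G \<sigma> + (n - m)"
proof -
  obtain T :: "nat set" and w c where T: "finite T" "card T + num_sign n G \<sigma> = n" "0 < c" and
    ge: "\<And>v. (\<forall>k\<in>T. (\<Sum>j<n. w k j * v j) = 0) \<Longrightarrow> c * (\<Sum>i<n. (v i)\<^sup>2) \<le> \<sigma> * qform n G v"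
    using coercive_on_codim[OF sym, of \<sigma>] by blast
  have "m \<le> num_sign m G \<sigma> + card T"
  proof (rule definite_on_codim[OF symmetric_on_subset[OF sym mn] T(1), of w])
    fix v assume v: "\<And>k. k \<in> T \<Longrightarrow> (\<Sum>j<m. w k j * v j) = 0" and v0: "\<exists>j<m. v j \<noteq> 0"
    define u where "u j = (if j < m then v j else 0)" for j
    have "(\<Sum>j<n. w k j * u j) = 0" if "k \<in> T" for k
    proof -
      have "(\<Sum>j<n. w k j * u j) = (\<Sum>j<m. w k j * u j)"
        using mn by (intro sum.mono_neutral_right) (auto simp: u_def)
      then show ?thesis using v[OF that] by (simp add: u_def)
    qed
    then have "c * (\<Sum>i<n. (u i)\<^sup>2) \<le> \<sigma> * qform n G u" by (intro ge) auto
    moreover have "\<exists>j<n. u j \<noteq> 0" using v0 mn by (auto simp: u_def)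
    ultimately have "0 < \<sigma> * qform n G u"
      using mult_pos_pos[OF T(3) sum_squares_pos[of n u]] by (meson less_le_trans)
    also have "qform n G u = qform m G v"
      using qform_submatrix[OF mn, of u G] by (simp add: u_def qform_def)
    finally show "0 < \<sigma> * qform m G v" .
  qed
  then show ?thesis using T(2) mn by linarith
qed

lemma kernel_trivial_imp_invertible:
  fixes G :: "nat \<Rightarrow> nat \<Rightarrow> real"
  assumes "\<And>v. (\<And>i. i < n \<Longrightarrow> (\<Sum>j<n. G i j * v j) = 0) \<Longrightarrow> \<forall>j<n. v j = 0"
  shows "invertible_mat (mat n n (\<lambda>(i, j). G i j))"
proof -
  let ?A = "mat n n (\<lambda>(i, j). G i j)"
  have A: "?A \<in> carrier_mat n n" by simp
  have "det ?A \<noteq> 0"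
  proof
    assume "det ?A = 0"
    then obtain x where x: "x \<in> carrier_vec n" "x \<noteq> 0\<^sub>v n" "?A *\<^sub>v x = 0\<^sub>v n"
      using det_0_iff_vec_prod_zero[OF A] by auto
    have "(\<Sum>j<n. G i j * x $ j) = 0" if "i < n" for i
      using arg_cong[OF x(3), of "\<lambda>y. y $ i"] that x(1)
      by (simp add: scalar_prod_def lessThan_atLeast0)
    then have "\<forall>j<n. x $ j = 0" using assms[of "\<lambda>j. x $ j"] by blast
    then have "x = 0\<^sub>v n" using x(1) by (intro eq_vecI) auto
    then show False using x(2) by simp
  qed
  from det_non_zero_imp_unit[OF A this, of "()"]
  show ?thesis unfolding Units_def ring_mat_def invertible_mat_def inverts_mat_def square_mat.simps
    by auto
qed

lemma invertible_imp_num_zero: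
  assumes sym: "symmetric_on n G" and inv: "invertible_mat (mat n n (\<lambda>(i, j). G i j))"
  shows "num_zero n G = 0"
proof (rule num_zero_eq_0_if_kernel_trivial[OF sym])
  fix v assume v: "\<And>i. i < n \<Longrightarrow> (\<Sum>j<n. G i j * v j) = 0"
  let ?A = "mat n n (\<lambda>(i, j). G i j)"
  obtain B where AB: "?A * B = 1\<^sub>m n" and BA: "B * ?A = 1\<^sub>m (dim_row B)"
    using inv unfolding invertible_mat_def inverts_mat_def by auto
  have B: "B \<in> carrier_mat n n"
    using arg_cong[OF AB, of dim_col] arg_cong[OF BA, of dim_col] by (intro carrier_matI) auto
  have "?A *\<^sub>v vec n v = 0\<^sub>v n"
    using v by (intro eq_vecI) (auto simp: scalar_prod_def lessThan_atLeast0)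
  then have "B *\<^sub>v (?A *\<^sub>v vec n v) = 0\<^sub>v n" using B by auto
  also have "B *\<^sub>v (?A *\<^sub>v vec n v) = (B * ?A) *\<^sub>v vec n v"
    using B by (intro assoc_mult_mat_vec[symmetric, of _ n n _ n]) auto
  also have "\<dots> = vec n v" using BA B by simp
  finally have eq: "vec n v = 0\<^sub>v n" .
  show "\<forall>j<n. v j = 0"
  proof (intro allI impI)
    fix j assume "j < n" then show "v j = 0" using arg_cong[OF eq, of "\<lambda>y. y $ j"] by simp
  qed
qed

section \<open>Kwong matrices: nonsingularity by a rule of signs\<close>

definition positive_nodes :: "nat \<Rightarrow> (nat \<Rightarrow> real) \<Rightarrow> bool" where
  "positive_nodes n p \<longleftrightarrow> (\<forall>i<n. 0 < p i) \<and> (\<forall>i j. i < j \<longrightarrow> j < n \<longrightarrow> p i < p j)"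

definition kwong :: "(nat \<Rightarrow> real) \<Rightarrow> real \<Rightarrow> nat \<Rightarrow> nat \<Rightarrow> real" where
  "kwong p r i j = (p i powr r + p j powr r) / (p i + p j)"

lemma positive_nodesD:
  assumes "positive_nodes n p"
  shows "i < n \<Longrightarrow> 0 < p i" and "i < j \<Longrightarrow> j < n \<Longrightarrow> p i < p j"
  using assms unfolding positive_nodes_def by blast+

lemma positive_nodes_subset: "positive_nodes n p \<Longrightarrow> m \<le> n \<Longrightarrow> positive_nodes m p"
  unfolding positive_nodes_def by auto

lemma symmetric_on_kwong: "symmetric_on n (kwong p r)"
  unfolding symmetric_on_def kwong_def by (simp add: add.commute)

lemma kwong_inertia_eq:
  "kwong_inertia n p r = (num_sign n (kwong p r) 1, num_zero n (kwong p r), num_sign n (kwong p r) (-1))"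
  unfolding inertia_def eig_count_def kwong_mat_def kwong_def by simp

text \<open>The exponents that make the Kwong matrix of size \<open>n\<close> singular. Negative exponents are included
  because the inertia for \<open>-1 < r \<le> 0\<close> is used too: the reduction of \<open>r\<close> by multiples of \<open>2\<close> ends in
  \<open>(-1, 1)\<close>.\<close>
definition exceptional :: "nat \<Rightarrow> real \<Rightarrow> bool" where
  "exceptional n r \<longleftrightarrow> (\<exists>m::int. odd m \<and> \<bar>m\<bar> < int n \<and> r = of_int m)"

lemma rolle_between_zeros:
  fixes f f' :: "real \<Rightarrow> real" and z :: "nat \<Rightarrow> real"
  assumes f': "\<And>x. x > 0 \<Longrightarrow> (f has_real_derivative f' x) (at x)"
    and z: "\<And>i. i \<le> n \<Longrightarrow> 0 < z i \<and> f (z i) = 0"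
    and mono: "\<And>i j. i < j \<Longrightarrow> j \<le> n \<Longrightarrow> z i < z j"
  shows "\<exists>y :: nat \<Rightarrow> real. (\<forall>i<n. 0 < y i \<and> f' (y i) = 0) \<and> (\<forall>i j. i < j \<longrightarrow> j < n \<longrightarrow> y i < y j)"
proof -
  have "\<exists>t. z i < t \<and> t < z (Suc i) \<and> f' t = 0" if i: "i < n" for i
  proof -
    have pos: "0 < x" if "z i \<le> x" for x using z[of i] i that by auto
    have "continuous_on {z i .. z (Suc i)} f"
      using pos f' by (intro continuous_at_imp_continuous_on ballI DERIV_isCont[OF f']) auto
    then obtain t where t: "z i < t" "t < z (Suc i)" and D: "(\<lambda>y. f' t * y) = (\<lambda>v. 0)"
      using Rolle_deriv[of "z i" "z (Suc i)" f "\<lambda>x y. f' x * y"] z[of i] z[of "Suc i"] mono[of i "Suc i"] i f' pos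
      by (auto simp: has_field_derivative_def)
    have "f' t = 0" using fun_cong[OF D, of 1] by simp
    with t show ?thesis by auto
  qed
  then obtain y where y: "\<And>i. i < n \<Longrightarrow> z i < y i \<and> y i < z (Suc i) \<and> f' (y i) = 0" by metis
  have "y i < y j" if "i < j" "j < n" for i j
  proof -
    have "z (Suc i) \<le> z j" using mono[of "Suc i" j] that by (cases "Suc i = j") auto
    then show ?thesis using y[of i] y[of j] that by auto
  qed
  moreover have "0 < y i" if "i < n" for i using y[OF that] z[of i] that by auto
  ultimately show ?thesis using y by blast
qed

text \<open>Induction on the number of monomials: after division by one of them, differentiation removes
  that monomial and, by Rolle's theorem, at most one zero.\<close>
lemma generalized_descartes:
  fixes a e :: "'a \<Rightarrow> real" and z :: "nat \<Rightarrow> real"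
  assumes "finite S" and "inj_on e S"
    and "\<And>i. i < card S \<Longrightarrow> 0 < z i \<and> (\<Sum>l\<in>S. a l * z i powr e l) = 0"
    and "\<And>i j. i < j \<Longrightarrow> j < card S \<Longrightarrow> z i < z j"
  shows "\<forall>l\<in>S. a l = 0"
  using assms
proof (induction S arbitrary: a e z rule: finite_induct)
  case empty
  then show ?case by simp
next
  case (insert m S)
  define f where "f x = (\<Sum>l\<in>insert m S. a l * x powr (e l - e m))" for x
  define f' where "f' x = (\<Sum>l\<in>S. (a l * (e l - e m)) * x powr (e l - e m - 1))" for x
  have card: "card (insert m S) = Suc (card S)" using insert.hyps by simp
  have f_zero: "0 < z i \<and> f (z i) = 0" if "i \<le> card S" for i
  proof -
    have zi: "0 < z i" "(\<Sum>l\<in>insert m S. a l * z i powr e l) = 0"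
      using insert.prems(2)[of i] that card by auto
    have "f (z i) = z i powr (- e m) * (\<Sum>l\<in>insert m S. a l * z i powr e l)"
      unfolding f_def sum_distrib_left
      by (intro sum.cong refl) (simp add: powr_diff powr_minus field_simps)
    then show ?thesis using zi by simp
  qed
  have deriv: "(f has_real_derivative f' x) (at x)" if "x > 0" for x
  proof -
    have "(f has_real_derivative (\<Sum>l\<in>insert m S. a l * ((e l - e m) * x powr (e l - e m - 1)))) (at x)"
      unfolding f_def by (intro DERIV_sum DERIV_cmult has_real_derivative_powr that)
    then show ?thesis unfolding f'_def using insert.hyps by (simp add: mult.assoc)
  qed
  have "\<exists>y. (\<forall>i<card S. 0 < y i \<and> f' (y i) = 0) \<and> (\<forall>i j. i < j \<longrightarrow> j < card S \<longrightarrow> y i < y j)"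
    using deriv f_zero insert.prems(3) card by (intro rolle_between_zeros[of f f' _ z]) auto
  then obtain y where y: "\<And>i. i < card S \<Longrightarrow> 0 < y i \<and> f' (y i) = 0"
    "\<And>i j. i < j \<Longrightarrow> j < card S \<Longrightarrow> y i < y j" by blast
  have "\<forall>l\<in>S. a l * (e l - e m) = 0"
  proof (rule insert.IH)
    show "inj_on (\<lambda>l. e l - e m - 1) S" using insert.prems(1) by (auto simp: inj_on_def)
  qed (use y in \<open>auto simp: f'_def\<close>)
  moreover have "e l \<noteq> e m" if "l \<in> S" for l
    using insert.prems(1) insert.hyps that by (auto simp: inj_on_def)
  ultimately have S0: "\<forall>l\<in>S. a l = 0" by auto
  have "(\<Sum>l\<in>insert m S. a l * z 0 powr e l) = a m * z 0 powr e m"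
    using insert.hyps S0 by simp
  then show ?case using insert.prems(2)[of 0] card S0 by auto
qed

text \<open>With \<open>P = \<Sum>\<^sub>j c\<^sub>j L\<^sub>j\<close> and \<open>Q = \<Sum>\<^sub>j c\<^sub>j p\<^sub>j\<^sup>r L\<^sub>j\<close>, where \<open>L\<^sub>j\<close> is the product of all
  \<open>x + p\<^sub>i\<close> except \<open>x + p\<^sub>j\<close>, the kernel equations say that \<open>x\<^sup>r P + Q\<close> vanishes at the nodes. The values at the negated nodes
  allow the splitting into two combinations of only \<open>n\<close> monomials each.\<close>
lemma kwong_kernel_trivial:
  assumes nodes: "positive_nodes n p" and generic: "\<not> exceptional n r"
    and ker0: "\<And>i. i < n \<Longrightarrow> (\<Sum>j<n. kwong p r i j * c j) = 0"
  shows "\<forall>j<n. c j = 0"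
proof -
  note pos = positive_nodesD(1)[OF nodes] and mono = positive_nodesD(2)[OF nodes]
  have r: "r \<noteq> of_int m" if "odd m" "\<bar>m\<bar> < int n" for m :: int
    using generic that unfolding exceptional_def by blast
  have ker: "(\<Sum>j<n. (p i powr r + p j powr r) / (p i + p j) * c j) = 0" if "i < n" for i
    using ker0[OF that] unfolding kwong_def .
  define L where "L j = (\<Prod>i\<in>{..<n} - {j}. [:p i, 1:])" for j
  define P where "P = (\<Sum>j<n. Polynomial.smult (c j) (L j))"
  define Q where "Q = (\<Sum>j<n. Polynomial.smult (c j * p j powr r) (L j))"
  have inj: "inj_on p {..<n}"
    by (rule linorder_inj_onI) (use mono in \<open>auto simp: less_le\<close>)
  have degL: "degree (L j) < n" if "j < n" for j
  proof -
    have "degree (L j) \<le> (\<Sum>i\<in>{..<n} - {j}. degree [:p i, 1:])"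
      unfolding L_def using degree_prod_sum_le[of "{..<n} - {j}" "\<lambda>i. [:p i, 1:]"] by (simp add: o_def)
    also have "\<dots> = n - 1" using that by simp
    finally show ?thesis using that by simp
  qed
  have coeffL: "coeff (L j) l = 0" if "j < n" "l \<ge> n" for j l
    using degL[OF that(1)] that(2) by (intro coeff_eq_0) simp
  have coeff0: "coeff P l = 0" "coeff Q l = 0" if "l \<ge> n" for l
    unfolding P_def Q_def using that by (auto simp: coeff_sum coeffL intro!: sum.neutral)
  have L_other: "poly (L j) (- p i) = 0" if "i < n" "j \<noteq> i" for i j
    unfolding L_def poly_prod using that by (intro prod_zero) auto
  have P_at: "poly P (- p i) = c i * poly (L i) (- p i)" 
    and Q_at: "poly Q (- p i) = c i * p i powr r * poly (L i) (- p i)" if "i < n" for i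
    unfolding P_def Q_def using that L_other by (auto simp: poly_sum sum.remove[of "{..<n}" i] intro!: sum.neutral)
  have L_self: "poly (L i) (- p i) \<noteq> 0" if "i < n" for i
    unfolding L_def poly_prod using that inj by (auto simp: inj_on_def)
  have PQ: "p i powr r * poly P (p i) + poly Q (p i) = 0" if i: "i < n" for i
  proof -
    define w where "w = (\<Prod>k<n. p i + p k)"
    have Lw: "poly (L j) (p i) = w / (p i + p j)" if "j < n" for j
    proof -
      have "p i + p j > 0" using pos i that by (simp add: add_pos_pos)
      moreover have "w = (p i + p j) * poly (L j) (p i)"
        unfolding w_def L_def poly_prod using that by (simp add: prod.remove[of _ j] add.commute)
      ultimately show ?thesis by simp
    qed
    have "p i powr r * poly P (p i) + poly Q (p i)
        = w * (\<Sum>j<n. (p i powr r + p j powr r) / (p i + p j) * c j)"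
      unfolding P_def Q_def poly_sum sum_distrib_left sum.distrib[symmetric]
      by (intro sum.cong refl) (simp add: Lw add_divide_distrib algebra_simps)
    then show ?thesis using ker[OF i] by simp
  qed
  have QP: "poly Q (- p i) = p i powr r * poly P (- p i)" if "i < n" for i
    using P_at[OF that] Q_at[OF that] by simp
  have expand: "poly R x = (\<Sum>l<n. coeff R l * x ^ l)" if "\<And>l. l \<ge> n \<Longrightarrow> coeff R l = 0" for R :: "real poly" and x
  proof -
    have "poly R x = (\<Sum>l\<le>degree R. coeff R l * x ^ l)" by (rule poly_altdef)
    also have "\<dots> = (\<Sum>l\<in>{..<n} \<union> {..degree R}. coeff R l * x ^ l)"
      by (rule sum.mono_neutral_left) (auto simp: coeff_eq_0)
    also have "\<dots> = (\<Sum>l<n. coeff R l * x ^ l)"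
      by (rule sum.mono_neutral_right) (auto simp: that)
    finally show ?thesis .
  qed
  have e_neq: "real l + r \<noteq> real l'" if "l < n" "l' < n" "even l \<noteq> even l'" for l l'
  proof -
    have "\<bar>int l' - int l\<bar> < int n" "odd (int l' - int l)" using that by auto
    from r[OF this(2,1)] show ?thesis by auto
  qed
  have inj_e: "inj_on (\<lambda>l. if even l = b then real l + r else real l) {..<n}" for b
    by (rule inj_onI) (use e_neq in \<open>auto split: if_splits, metis+\<close>)
  (* Both combinations at once: b selects the parity of the part of P that is multiplied by x^r. *)
  have parity: "\<forall>l<n. (if even l = b then coeff P l else coeff Q l) = 0" for b
  proof -
    define s :: real where "s = (if b then 1 else -1)"
    have sl: "s * (-1) ^ l = (if even l = b then 1 else -1)" for l :: nat
      unfolding s_def by auto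
    have "\<forall>l\<in>{..<n}. (if even l = b then coeff P l else coeff Q l) = 0"
    proof (rule generalized_descartes[OF finite_lessThan inj_e[of b], where z = p])
      fix i assume "i < card {..<n}"
      then have i: "i < n" by simp
      have pl: "p i powr real l = p i ^ l" for l using pos[OF i] by (simp add: powr_realpow)
      have "(p i powr r * poly P (p i) + poly Q (p i))
          + s * (p i powr r * poly P (- p i) - poly Q (- p i)) = 0"
        using PQ[OF i] QP[OF i] by simp
      also have "(p i powr r * poly P (p i) + poly Q (p i))
          + s * (p i powr r * poly P (- p i) - poly Q (- p i))
        = (\<Sum>l<n. p i powr r * (1 + s * (-1) ^ l) * coeff P l * p i ^ l
             + (1 - s * (-1) ^ l) * coeff Q l * p i ^ l)"
      proof -
        have at_neg: "poly R (- p i) = (\<Sum>l<n. coeff R l * ((-1) ^ l * p i ^ l))"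
          if "\<And>l. l \<ge> n \<Longrightarrow> coeff R l = 0" for R
          using expand[OF that, of "- p i"] unfolding power_minus[of "p i"] .
        have "poly P (p i) = (\<Sum>l<n. coeff P l * p i ^ l)" "poly Q (p i) = (\<Sum>l<n. coeff Q l * p i ^ l)"
          "poly P (- p i) = (\<Sum>l<n. coeff P l * ((-1) ^ l * p i ^ l))"
          "poly Q (- p i) = (\<Sum>l<n. coeff Q l * ((-1) ^ l * p i ^ l))"
          by (rule expand[OF coeff0(1)], assumption) (rule expand[OF coeff0(2)] at_neg[OF coeff0(1)] at_neg[OF coeff0(2)], assumption)+
        then show ?thesis
          by (simp only: sum_distrib_left sum.distrib[symmetric] sum_subtractf[symmetric])
            (intro sum.cong refl, simp add: algebra_simps)
      qed
      also have "\<dots> = 2 * (\<Sum>l<n. (if even l = b then coeff P l else coeff Q l) *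
          p i powr (if even l = b then real l + r else real l))"
        unfolding sl sum_distrib_left
        by (intro sum.cong refl) (auto simp: powr_add pl)
      finally show "0 < p i \<and> (\<Sum>l<n. (if even l = b then coeff P l else coeff Q l) *
          p i powr (if even l = b then real l + r else real l)) = 0"
        using pos[OF i] by simp
    qed (use mono in auto)
    then show ?thesis by auto
  qed
  have "P = 0"
  proof (rule poly_eqI)
    fix l show "coeff P l = coeff 0 l"
      using parity[of "even l"] coeff0(1)[of l] by (cases "l < n") auto
  qed
  then show ?thesis using P_at L_self by auto
qed

section \<open>Inertia of Kwong matrices\<close>

lemma kwong_num_zero:
  assumes "positive_nodes n p" and "\<not> exceptional n r"
  shows "num_zero n (kwong p r) = 0"
  by (rule num_zero_eq_0_if_kernel_trivial[OF symmetric_on_kwong])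
    (use kwong_kernel_trivial[OF assms] in blast)

lemma kwong_signature_const:
  assumes nodes: "positive_nodes n p" and conn: "connected X"
    and X: "\<And>t. t \<in> X \<Longrightarrow> \<not> exceptional n t" and ab: "a \<in> X" "b \<in> X"
    and \<sigma>: "\<sigma> = 1 \<or> \<sigma> = -1"
  shows "num_sign n (kwong p a) \<sigma> = num_sign n (kwong p b) \<sigma>"
proof -
  have "num_sign n (kwong p a) 1 = num_sign n (kwong p b) 1 \<and>
    num_sign n (kwong p a) (-1) = num_sign n (kwong p b) (-1)"
  proof (rule signature_const_on_connected[OF conn symmetric_on_kwong _ _ ab])
    fix i j assume ij: "i < n" "j < n"
    then have "p i > 0" "p j > 0" using positive_nodesD[OF nodes] by auto
    then show "continuous_on X (\<lambda>t. kwong p t i j)"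
      unfolding kwong_def by (intro continuous_intros) auto
  qed (use X kwong_num_zero[OF nodes] in auto)
  then show ?thesis using \<sigma> by blast
qed

text \<open>Elimination of the last node \<open>a\<close> by
  \<open>1 / (x + y) = 2 a / ((x + a) (y + a)) + (x - a) (y - a) / ((x + a) (y + a) (x + y))\<close>: the form is
  a square plus the form of the remaining nodes. Vanishing is traced along to get definiteness.\<close>
lemma cauchy_form_positive:
  assumes "positive_nodes n p"
  shows "0 \<le> (\<Sum>i<n. \<Sum>j<n. c i * c j / (p i + p j)) \<and>
    ((\<Sum>i<n. \<Sum>j<n. c i * c j / (p i + p j)) = 0 \<longrightarrow> (\<forall>i<n. c i = 0))"
  using assms
proof (induction n arbitrary: c)
  case 0
  then show ?case by simp
next
  case (Suc n)
  define a where "a = p n"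
  define c' where "c' i = c i * (p i - a) / (p i + a)" for i
  have pos: "0 < p i" if "i < Suc n" for i using positive_nodesD[OF Suc.prems] that by auto
  have a: "a > 0" unfolding a_def using pos by simp
  have split: "c i * c j / (p i + p j) =
      2 * a * (c i / (p i + a) * (c j / (p j + a))) + c' i * c' j / (p i + p j)"
    if "i < Suc n" "j < Suc n" for i j
  proof -
    have "p i + p j \<noteq> 0" "p i + a \<noteq> 0" "p j + a \<noteq> 0" using pos[OF that(1)] pos[OF that(2)] a by auto
    then show ?thesis unfolding c'_def by (simp add: divide_simps) (simp add: algebra_simps)
  qed
  let ?F = "\<Sum>i<n. \<Sum>j<n. c' i * c' j / (p i + p j)"
  let ?L = "\<Sum>i<Suc n. c i / (p i + a)"
  have "c' n = 0" unfolding c'_def a_def by simp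
  then have F_eq: "(\<Sum>i<Suc n. \<Sum>j<Suc n. c' i * c' j / (p i + p j)) = ?F" by simp
  have eq: "(\<Sum>i<Suc n. \<Sum>j<Suc n. c i * c j / (p i + p j)) = 2 * a * ?L\<^sup>2 + ?F"
  proof -
    have "?L\<^sup>2 = (\<Sum>i<Suc n. \<Sum>j<Suc n. c i / (p i + a) * (c j / (p j + a)))"
      unfolding power2_eq_square sum_product ..
    then have L2: "2 * a * ?L\<^sup>2 = (\<Sum>i<Suc n. \<Sum>j<Suc n. 2 * a * (c i / (p i + a) * (c j / (p j + a))))"
      by (simp only: sum_distrib_left)
    have "(\<Sum>i<Suc n. \<Sum>j<Suc n. c i * c j / (p i + p j)) = (\<Sum>i<Suc n. \<Sum>j<Suc n.
        2 * a * (c i / (p i + a) * (c j / (p j + a))) + c' i * c' j / (p i + p j))"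
      by (intro sum.cong refl split) auto
    also have "\<dots> = 2 * a * ?L\<^sup>2 + (\<Sum>i<Suc n. \<Sum>j<Suc n. c' i * c' j / (p i + p j))"
      by (simp only: sum.distrib L2)
    finally show ?thesis unfolding F_eq .
  qed
  have IH: "0 \<le> ?F" "?F = 0 \<Longrightarrow> \<forall>i<n. c' i = 0"
    using Suc.IH[of c'] positive_nodes_subset[OF Suc.prems, of n] by auto
  have "\<forall>i<Suc n. c i = 0" if z: "2 * a * ?L\<^sup>2 + ?F = 0"
  proof -
    have "0 \<le> 2 * a * ?L\<^sup>2" using a by simp
    then have "?F = 0" "2 * a * ?L\<^sup>2 = 0" using z IH(1) by linarith+
    then have c'0: "\<forall>i<n. c' i = 0" and L: "?L = 0" using IH(2) a by auto
    have cn: "c i = 0" if "i < n" for i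
      using c'0 that pos[of i] a positive_nodesD(2)[OF Suc.prems, of i n]
      unfolding c'_def a_def by auto
    have "?L = c n / (p n + a)" using cn by simp
    then have "c n = 0" using L a unfolding a_def by simp
    then show ?thesis using cn by (auto simp: less_Suc_eq)
  qed
  moreover have "0 \<le> 2 * a * ?L\<^sup>2 + ?F"
    using a IH(1) by (intro add_nonneg_nonneg mult_nonneg_nonneg zero_le_power2) auto
  ultimately show ?case unfolding eq by blast
qed

text \<open>No exponent in \<open>(-1, 1)\<close> is exceptional, so the inertia is that of \<open>r = 0\<close>, which is twice the
  Cauchy matrix.\<close>
lemma kwong_positive_definite:
  assumes nodes: "positive_nodes n p" and r: "\<bar>r\<bar> < 1" and v: "\<exists>j<n. v j \<noteq> 0"
  shows "0 < qform n (kwong p r) v"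
proof (rule positive_definite_if_num_sign_full[OF symmetric_on_kwong _ v])
  have "n \<le> num_sign n (kwong p 0) 1 + card ({} :: nat set)"
  proof (rule definite_on_codim[OF symmetric_on_kwong])
    fix v :: "nat \<Rightarrow> real" assume v: "\<exists>j<n. v j \<noteq> 0"
    have "qform n (kwong p 0) v = 2 * (\<Sum>i<n. \<Sum>j<n. v i * v j / (p i + p j))"
      unfolding qform_def kwong_def sum_distrib_left using positive_nodesD(1)[OF nodes]
      by (intro sum.cong refl) (auto simp: less_imp_neq[THEN not_sym])
    then show "0 < 1 * qform n (kwong p 0) v"
      using cauchy_form_positive[OF nodes, of v] v by (auto simp: less_le)
  qed auto
  then have "num_sign n (kwong p 0) 1 = n"
    using signature_total[OF symmetric_on_kwong, of 1 n p 0] by simp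
  moreover have "num_sign n (kwong p 0) 1 = num_sign n (kwong p r) 1"
  proof (rule kwong_signature_const[OF nodes, of "{-1<..<1}"])
    fix t :: real assume t: "t \<in> {-1<..<1}"
    show "\<not> exceptional n t"
    proof
      assume "exceptional n t"
      then obtain m :: int where "odd m" "t = of_int m" unfolding exceptional_def by blast
      with t have "m = 0" by auto
      with \<open>odd m\<close> show False by simp
    qed
  qed (use r in auto)
  ultimately show "num_sign n (kwong p r) 1 = n" by simp
qed

text \<open>The terms \<open>x\<^bsup>r+1\<^esup> + y\<^bsup>r+1\<^esup>\<close> by which the two forms differ vanish when the entries of
  \<open>v\<close> sum to zero.\<close>
lemma kwong_form_step:
  assumes pos: "\<And>i. i < n \<Longrightarrow> 0 < p i" and sum0: "(\<Sum>i<n. v i) = 0"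
  shows "qform n (kwong p (r + 2)) v = - qform n (kwong p r) (\<lambda>i. p i * v i)"
proof -
  have entry: "kwong p (r + 2) i j = p i powr (r + 1) + p j powr (r + 1) - p i * p j * kwong p r i j"
    if "i < n" "j < n" for i j
  proof -
    have pos': "0 < p i" "0 < p j" using pos that by auto
    then have "p i + p j \<noteq> 0" by simp
    moreover have "x powr (r + 2) = x powr r * x\<^sup>2" "x powr (r + 1) = x powr r * x" if "0 < x" for x
      using that by (simp_all add: powr_add)
    ultimately show ?thesis unfolding kwong_def using pos'
      by (simp add: divide_simps) (simp add: power2_eq_square algebra_simps)
  qed
  have "qform n (kwong p (r + 2)) v =
      (\<Sum>i<n. v i * (\<Sum>j<n. p i powr (r + 1) * v j + p j powr (r + 1) * v j - p i * p j * kwong p r i j * v j))"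
    unfolding qform_def by (intro sum.cong refl arg_cong2[of _ _ _ _ "(*)"]) (simp add: entry algebra_simps)
  also have "\<dots> = (\<Sum>i<n. v i * p i powr (r + 1) * (\<Sum>j<n. v j) + v i * (\<Sum>j<n. p j powr (r + 1) * v j)
      - p i * v i * (\<Sum>j<n. kwong p r i j * (p j * v j)))"
    by (intro sum.cong refl) (simp add: sum.distrib sum_subtractf sum_distrib_left sum_distrib_right algebra_simps)
  also have "\<dots> = (\<Sum>i<n. v i) * (\<Sum>j<n. p j powr (r + 1) * v j) - qform n (kwong p r) (\<lambda>i. p i * v i)"
  proof -
    have "(\<Sum>i<n. v i * t) = 0" for t unfolding sum_distrib_right[symmetric] sum0 by simp
    then show ?thesis unfolding qform_def sum_subtractf sum.distrib sum0 by simp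
  qed
  finally show ?thesis using sum0 by simp
qed

lemma kwong_form_iterated:
  assumes pos: "\<And>i. i < n \<Longrightarrow> 0 < p i" and "\<And>l. l < M \<Longrightarrow> (\<Sum>i<n. p i ^ l * v i) = 0"
  shows "qform n (kwong p (s + 2 * real M)) v = (-1) ^ M * qform n (kwong p s) (\<lambda>i. p i ^ M * v i)"
  using assms(2)
proof (induction M arbitrary: v)
  case 0
  then show ?case by simp
next
  case (Suc M)
  have "qform n (kwong p (s + 2 * real (Suc M))) v = qform n (kwong p ((s + 2 * real M) + 2)) v"
    by (simp add: algebra_simps)
  also have "\<dots> = - qform n (kwong p (s + 2 * real M)) (\<lambda>i. p i * v i)"
    using Suc.prems[of 0] by (intro kwong_form_step pos) auto
  also have "qform n (kwong p (s + 2 * real M)) (\<lambda>i. p i * v i)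
      = (-1) ^ M * qform n (kwong p s) (\<lambda>i. p i ^ M * (p i * v i))"
    using Suc.prems[of "Suc _"] by (intro Suc.IH) (simp add: mult_ac)
  finally show ?case by (simp add: mult_ac)
qed

text \<open>The \<open>M\<close> equations are the vanishing of the first \<open>M\<close> moments; the form is then \<open>(-1)\<^sup>M\<close> times the
  positive definite one with exponent \<open>r - 2 M\<close>.\<close>
lemma kwong_definite_on_codim:
  assumes nodes: "positive_nodes n p" and r: "2 * real M - 1 < r" "r < 2 * real M + 1"
  shows "n \<le> num_sign n (kwong p r) ((-1) ^ M) + M"
proof -
  have "n \<le> num_sign n (kwong p r) ((-1) ^ M) + card {..<M}"
  proof (rule definite_on_codim[OF symmetric_on_kwong finite_lessThan, of M "\<lambda>l i. p i ^ l"])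
    fix v assume v: "\<And>l. l \<in> {..<M} \<Longrightarrow> (\<Sum>i<n. p i ^ l * v i) = 0" and v0: "\<exists>j<n. v j \<noteq> 0"
    note pos = positive_nodesD(1)[OF nodes]
    have eq: "qform n (kwong p r) v
        = (-1) ^ M * qform n (kwong p (r - 2 * real M)) (\<lambda>i. p i ^ M * v i)"
      using kwong_form_iterated[OF pos v, of M "r - 2 * real M"] by simp
    have "\<exists>j<n. p j ^ M * v j \<noteq> 0" using v0 pos by fastforce
    then have "0 < qform n (kwong p (r - 2 * real M)) (\<lambda>i. p i ^ M * v i)"
      using r by (intro kwong_positive_definite[OF nodes]) auto
    then show "0 < (-1) ^ M * qform n (kwong p r) v"
      unfolding eq mult.assoc[symmetric] power_mult_distrib[symmetric] by simp
  qed
  then show ?thesis by simp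
qed

text \<open>Nonsingularity of the Vandermonde matrix: a polynomial of degree below \<open>r\<close> that vanishes at
  all but one of the first \<open>r\<close> nodes isolates the corresponding entry.\<close>
lemma moments_zero_imp_zero:
  assumes nodes: "positive_nodes n p" and rn: "r \<le> n"
    and supp: "\<And>j. r \<le> j \<Longrightarrow> j < n \<Longrightarrow> v j = 0"
    and mom: "\<And>l. l < r \<Longrightarrow> (\<Sum>j<n. p j ^ l * v j) = 0"
  shows "\<forall>j<n. v j = 0"
proof (intro allI impI)
  fix i assume i: "i < n"
  show "v i = 0"
  proof (cases "i < r")
    case True
    define q where "q = (\<Prod>k\<in>{..<r} - {i}. [:- p k, 1:])"
    have "degree q \<le> r - 1"
      unfolding q_def using degree_prod_sum_le[of "{..<r} - {i}" "\<lambda>k. [:- p k, 1:]"] True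
      by (simp add: o_def)
    then have deg: "degree q < r" using True by simp
    have "(\<Sum>j<n. poly q (p j) * v j) = (\<Sum>j<n. \<Sum>l\<le>degree q. coeff q l * (p j ^ l * v j))"
      unfolding poly_altdef by (simp add: sum_distrib_right mult.assoc)
    also have "\<dots> = (\<Sum>l\<le>degree q. coeff q l * (\<Sum>j<n. p j ^ l * v j))"
      unfolding sum_distrib_left by (rule sum.swap)
    also have "\<dots> = 0" using mom deg by simp
    also have "(\<Sum>j<n. poly q (p j) * v j) = poly q (p i) * v i"
    proof -
      have zero: "poly q (p j) * v j = 0" if "j < n" "j \<noteq> i" for j
        using supp[of j] that unfolding q_def poly_prod
        by (cases "j < r") (auto intro!: prod_zero)
      have "(\<Sum>j<n. poly q (p j) * v j) = (\<Sum>j\<in>{i}. poly q (p j) * v j)"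
        by (rule sum.mono_neutral_right) (use i zero in \<open>simp_all del: mult_eq_0_iff\<close>)
      then show ?thesis by simp
    qed
    finally have "poly q (p i) * v i = 0" .
    moreover have "poly q (p i) \<noteq> 0"
    proof -
      have "p i \<noteq> p k" if "k < r" "k \<noteq> i" for k
        using positive_nodesD(2)[OF nodes, of i k] positive_nodesD(2)[OF nodes, of k i] that i rn
        by (cases i k rule: linorder_cases) auto
      then show ?thesis unfolding q_def poly_prod by auto
    qed
    ultimately show ?thesis by simp
  qed (use supp i in auto)
qed

lemma power_sum_odd_factor:
  fixes x y :: real
  shows "x ^ (2 * h + 1) + y ^ (2 * h + 1) = (x + y) * (\<Sum>l<2 * h + 1. (-1) ^ l * x ^ (2 * h - l) * y ^ l)"
proof -
  have neg: "(- y) ^ l = (-1) ^ l * y ^ l" for l by (rule power_minus)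
  have "(- y) ^ (2 * h + 1) - x ^ (2 * h + 1) = (- y - x) * (\<Sum>l<2 * h + 1. x ^ (2 * h + 1 - Suc l) * (- y) ^ l)"
    by (rule power_diff_sumr2)
  then have "- (y ^ (2 * h + 1)) - x ^ (2 * h + 1)
      = - (x + y) * (\<Sum>l<2 * h + 1. (-1) ^ l * x ^ (2 * h - l) * y ^ l)"
    unfolding neg by (simp add: mult_ac del: sum.lessThan_Suc)
  then show ?thesis by (simp only: mult_minus_left)
qed

lemma alternating_sum_symmetric:
  fixes y :: "nat \<Rightarrow> real"
  shows "(\<Sum>l<2 * h + 1. (-1) ^ l * y (2 * h - l) * y l)
    = 2 * (\<Sum>l<h. (-1) ^ l * y (2 * h - l) * y l) + (-1) ^ h * (y h)\<^sup>2"
proof -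
  let ?g = "\<lambda>l. (-1) ^ l * y (2 * h - l) * y l"
  have "{..<2 * h + 1} = {..<h} \<union> {h} \<union> {h<..2 * h}" by auto
  moreover have "{..<h} \<inter> {h<..2 * h} = {}" by auto
  ultimately have "sum ?g {..<2 * h + 1} = sum ?g {..<h} + ?g h + sum ?g {h<..2 * h}"
    by (simp add: sum.union_disjoint)
  moreover have "sum ?g {h<..2 * h} = sum ?g {..<h}"
  proof (rule sum.reindex_bij_witness[of _ "\<lambda>l. 2 * h - l" "\<lambda>l. 2 * h - l"])
    fix l assume "l \<in> {h<..2 * h}"
    then have "(-1 :: real) ^ (2 * h - l) = (-1) ^ l" "2 * h - (2 * h - l) = l"
      by (auto simp: minus_one_power_iff)
    then show "?g (2 * h - l) = ?g l" by (simp add: mult_ac)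
  qed auto
  ultimately show ?thesis by (simp add: power2_eq_square mult_ac)
qed

context
  fixes n h :: nat and p :: "nat \<Rightarrow> real"
  assumes nodes: "positive_nodes n p" and hn: "2 * h + 1 \<le> n"
begin

lemma kwong_odd_apply:
  assumes "i < n"
  shows "(\<Sum>j<n. kwong p (real (2 * h + 1)) i j * v j)
    = (\<Sum>l<2 * h + 1. (-1) ^ l * p i ^ (2 * h - l) * (\<Sum>j<n. p j ^ l * v j))"
proof -
  have "kwong p (real (2 * h + 1)) i j = (\<Sum>l<2 * h + 1. (-1) ^ l * p i ^ (2 * h - l) * p j ^ l)"
    if "j < n" for j
  proof -
    have pos: "0 < p i" "0 < p j" using positive_nodesD(1)[OF nodes] assms that by auto
    then have "p i + p j \<noteq> 0" by simp
    moreover have "p i powr real (2 * h + 1) + p j powr real (2 * h + 1) = p i ^ (2 * h + 1) + p j ^ (2 * h + 1)"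
      using pos by (simp only: powr_realpow)
    ultimately show ?thesis unfolding kwong_def power_sum_odd_factor by simp
  qed
  then have "(\<Sum>j<n. kwong p (real (2 * h + 1)) i j * v j)
      = (\<Sum>j<n. \<Sum>l<2 * h + 1. (-1) ^ l * p i ^ (2 * h - l) * (p j ^ l * v j))"
    by (intro sum.cong refl) (simp add: sum_distrib_right mult.assoc del: sum.lessThan_Suc)
  also have "\<dots> = (\<Sum>l<2 * h + 1. \<Sum>j<n. (-1) ^ l * p i ^ (2 * h - l) * (p j ^ l * v j))"
    by (rule sum.swap)
  finally show ?thesis by (simp only: sum_distrib_left)
qed

lemma kwong_odd_form:
  "qform n (kwong p (real (2 * h + 1))) v
    = (\<Sum>l<2 * h + 1. (-1) ^ l * (\<Sum>i<n. p i ^ (2 * h - l) * v i) * (\<Sum>j<n. p j ^ l * v j))"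
proof -
  have "qform n (kwong p (real (2 * h + 1))) v
      = (\<Sum>i<n. \<Sum>l<2 * h + 1. v i * ((-1) ^ l * p i ^ (2 * h - l) * (\<Sum>j<n. p j ^ l * v j)))"
    unfolding qform_def by (intro sum.cong refl) (simp only: kwong_odd_apply lessThan_iff sum_distrib_left)
  also have "\<dots> = (\<Sum>l<2 * h + 1. \<Sum>i<n. v i * ((-1) ^ l * p i ^ (2 * h - l) * (\<Sum>j<n. p j ^ l * v j)))"
    by (rule sum.swap)
  also have "\<dots> = (\<Sum>l<2 * h + 1. (-1) ^ l * (\<Sum>i<n. p i ^ (2 * h - l) * v i) * (\<Sum>j<n. p j ^ l * v j))"
    by (intro sum.cong refl) (simp only: sum_distrib_left sum_distrib_right mult_ac)
  finally show ?thesis .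
qed

text \<open>In terms of the moments \<open>y\<^sub>l\<close> the form is
  \<open>2 \<Sum>\<^sub>l\<^sub><\<^sub>h (-1)\<^sup>l y\<^sub>l y\<^bsub>2h-l\<^esub> + (-1)\<^sup>h y\<^sub>h\<^sup>2\<close>. Imposing \<open>y\<^sub>l = \<sigma> (-1)\<^sup>l y\<^bsub>2h-l\<^esub>\<close> for \<open>l < h\<close>
  turns \<open>\<sigma>\<close> times each product into a square. If the middle term has the wrong sign, the same equation at \<open>l = h\<close>
  reads \<open>y\<^sub>h = 0\<close>. Restricting the vectors to the first \<open>2 h + 1\<close> nodes makes the moments
  determine them.\<close>
lemma kwong_odd_num_sign_ge:
  assumes \<sigma>: "\<sigma> = 1 \<or> \<sigma> = -1"
  shows "(if \<sigma> = (-1) ^ h then h + 1 else h) \<le> num_sign n (kwong p (real (2 * h + 1))) \<sigma>"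
proof -
  define L where "L = (if \<sigma> = (-1) ^ h then {..<h} else {..h})"
  define f where "f = case_sum (\<lambda>l j. p j ^ l - \<sigma> * (-1) ^ l * p j ^ (2 * h - l))
    (\<lambda>k j :: nat. if j = k then 1 else (0::real))"
  have "n \<le> num_sign n (kwong p (real (2 * h + 1))) \<sigma> + card (L <+> {2 * h + 1..<n})"
  proof (rule definite_on_codim[OF symmetric_on_kwong, of _ f])
    fix v assume v: "\<And>s. s \<in> L <+> {2 * h + 1..<n} \<Longrightarrow> (\<Sum>j<n. f s j * v j) = 0"
      and v0: "\<exists>j<n. v j \<noteq> 0"
    define y where "y l = (\<Sum>j<n. p j ^ l * v j)" for l
    have supp: "v k = 0" if "2 * h + 1 \<le> k" "k < n" for k
      using v[OF InrI, of k] that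
      by (simp add: f_def if_distrib[of "\<lambda>x. x * _"] sum.delta cong: if_cong)
    have yL: "y l = \<sigma> * (-1) ^ l * y (2 * h - l)" if "l \<in> L" for l
      using v[OF InlI[OF that]] unfolding f_def y_def
      by (simp add: left_diff_distrib sum_subtractf sum_distrib_left mult.assoc)
    have yl: "y l = \<sigma> * (-1) ^ l * y (2 * h - l)" if "l < h" for l
      using that by (intro yL) (auto simp: L_def)
    have mid: "\<sigma> * (-1) ^ h * (y h)\<^sup>2 = (y h)\<^sup>2"
    proof (cases "\<sigma> = (-1) ^ h")
      case True
      then show ?thesis by (simp add: power_mult_distrib[symmetric])
    next
      case False
      then have "\<sigma> * (-1) ^ h = -1" using \<sigma> by (cases "even h") auto
      then have "y h = 0" using yL[of h] False by (simp add: L_def)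
      then show ?thesis by simp
    qed
    have "\<sigma> * qform n (kwong p (real (2 * h + 1))) v
        = (\<Sum>l<h. 2 * (\<sigma> * (-1) ^ l * y (2 * h - l) * y l)) + \<sigma> * (-1) ^ h * (y h)\<^sup>2"
      unfolding kwong_odd_form y_def[symmetric] alternating_sum_symmetric
      by (simp add: sum_distrib_left algebra_simps)
    also have "\<dots> = (\<Sum>l<h. 2 * (y l)\<^sup>2) + (y h)\<^sup>2"
      unfolding mid using yl by (simp add: power2_eq_square)
    finally have eq: "\<sigma> * qform n (kwong p (real (2 * h + 1))) v = (\<Sum>l<h. 2 * (y l)\<^sup>2) + (y h)\<^sup>2" .
    have nonneg: "0 \<le> (\<Sum>l<h. 2 * (y l)\<^sup>2)" by (intro sum_nonneg) auto
    have "(\<Sum>l<h. 2 * (y l)\<^sup>2) + (y h)\<^sup>2 \<noteq> 0"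
    proof
      assume zero: "(\<Sum>l<h. 2 * (y l)\<^sup>2) + (y h)\<^sup>2 = 0"
      then have "(\<Sum>l<h. 2 * (y l)\<^sup>2) = 0" and yh: "y h = 0"
        using nonneg zero_le_power2[of "y h"] by (simp_all add: add_nonneg_eq_0_iff)
      then have low: "\<forall>l<h. y l = 0" by (subst (asm) sum_nonneg_eq_0_iff) auto
      have "y l = 0" if "l < 2 * h + 1" for l
      proof (cases l h rule: linorder_cases)
        case greater
        then have "y (2 * h - l) = \<sigma> * (-1) ^ (2 * h - l) * y (2 * h - (2 * h - l))"
          using that by (intro yl) auto
        moreover have "y (2 * h - l) = 0" "2 * h - (2 * h - l) = l" using low greater that by auto
        ultimately show ?thesis using \<sigma> by auto
      qed (use low yh in auto)
      then have "\<forall>j<n. v j = 0"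
        by (intro moments_zero_imp_zero[OF nodes hn]) (use supp in \<open>auto simp: y_def\<close>)
      then show False using v0 by auto
    qed
    then show "0 < \<sigma> * qform n (kwong p (real (2 * h + 1))) v"
      unfolding eq using nonneg by (simp add: less_le)
  qed (simp add: L_def)
  moreover have "card (L <+> {2 * h + 1..<n}) = (if \<sigma> = (-1) ^ h then h else h + 1) + (n - (2 * h + 1))"
    by (simp add: card_Plus L_def)
  ultimately show ?thesis using hn by (auto split: if_splits)
qed

text \<open>The lower bounds for the three counts already add up to \<open>n\<close>; those for the kernel come from
  the vanishing of all moments.\<close>
theorem kwong_odd_signature:
  shows "num_sign n (kwong p (real (2 * h + 1))) ((-1) ^ h) = h + 1"
    and "num_sign n (kwong p (real (2 * h + 1))) (- ((-1) ^ h)) = h"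
    and "num_zero n (kwong p (real (2 * h + 1))) = n - (2 * h + 1)"
proof -
  let ?G = "kwong p (real (2 * h + 1))"
  have "n \<le> num_zero n ?G + card {..<2 * h + 1}"
  proof (rule kernel_on_codim[OF symmetric_on_kwong finite_lessThan, of _ "\<lambda>l j. p j ^ l"])
    fix v i assume "\<And>l. l \<in> {..<2 * h + 1} \<Longrightarrow> (\<Sum>j<n. p j ^ l * v j) = 0" and "i < n"
    then show "(\<Sum>j<n. ?G i j * v j) = 0"
      unfolding kwong_odd_apply[OF \<open>i < n\<close>] by (intro sum.neutral) auto
  qed
  moreover have "h + 1 \<le> num_sign n ?G ((-1) ^ h)"
    using kwong_odd_num_sign_ge[of "(-1) ^ h"] by (cases "even h") auto
  moreover have "h \<le> num_sign n ?G (- ((-1) ^ h))"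
    using kwong_odd_num_sign_ge[of "- ((-1) ^ h)"] by (cases "even h") auto
  moreover have "num_sign n ?G ((-1) ^ h) + num_zero n ?G + num_sign n ?G (- ((-1) ^ h)) = n"
    by (rule signature_total[OF symmetric_on_kwong]) simp
  ultimately show "num_sign n ?G ((-1) ^ h) = h + 1" "num_sign n ?G (- ((-1) ^ h)) = h"
    "num_zero n ?G = n - (2 * h + 1)" using hn by simp_all
qed

end

lemma pm_one_power: "(-1 :: real) ^ M = 1 \<or> (-1 :: real) ^ M = -1"
  by (cases "even M") auto

lemma not_exceptional_tail:
  assumes "real (2 * M + 1) - 2 < r"
  shows "\<not> exceptional (2 * M + 1) r"
proof
  assume "exceptional (2 * M + 1) r"
  then obtain m :: int where m: "odd m" "\<bar>m\<bar> < int (2 * M + 1)" "r = of_int m"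
    unfolding exceptional_def by blast
  then have "2 * int M - 1 < m" using assms by linarith
  then show False using m by presburger
qed

text \<open>At \<open>r = 2 M + 1\<close> the matrix has size equal to its odd exponent, so
  its signature is known and it is nonsingular.\<close>
lemma kwong_odd_size_signature:
  assumes nodes: "positive_nodes (2 * M + 1) p" and r: "real (2 * M + 1) - 2 < r"
  shows "num_sign (2 * M + 1) (kwong p r) ((-1) ^ M) = M + 1"
    and "num_sign (2 * M + 1) (kwong p r) (- ((-1) ^ M)) = M"
proof -
  let ?N = "2 * M + 1"
  have "num_sign ?N (kwong p r) \<sigma> = num_sign ?N (kwong p (real ?N)) \<sigma>" if "\<sigma> = 1 \<or> \<sigma> = -1" for \<sigma>
    by (rule kwong_signature_const[OF nodes, of "{real ?N - 2<..}"])
      (use r that not_exceptional_tail in \<open>auto simp: connected_Ioi\<close>)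
  from this[of "(-1) ^ M"] this[of "- ((-1) ^ M)"] pm_one_power[of M] kwong_odd_signature[OF nodes order_refl]
  show "num_sign ?N (kwong p r) ((-1) ^ M) = M + 1" "num_sign ?N (kwong p r) (- ((-1) ^ M)) = M"
    by auto
qed

text \<open>The \<open>n - M\<close> eigenvalues of sign \<open>(-1)\<^sup>M\<close> come from vanishing moments, the \<open>M\<close> of the other sign from
  the leading principal submatrix of size \<open>2 M + 1\<close>.\<close>
lemma kwong_between_odd_signature:
  assumes nodes: "positive_nodes n p" and n: "2 * M + 1 \<le> n"
    and r: "2 * real M - 1 < r" "r < 2 * real M + 1"
  shows "num_sign n (kwong p r) ((-1) ^ M) = n - M"
    and "num_sign n (kwong p r) (- ((-1) ^ M)) = M"
    and "num_zero n (kwong p r) = 0"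
proof -
  have "n \<le> num_sign n (kwong p r) ((-1) ^ M) + M"
    by (rule kwong_definite_on_codim[OF nodes r])
  moreover have "M = num_sign (2 * M + 1) (kwong p r) (- ((-1) ^ M))"
    using r by (intro kwong_odd_size_signature[symmetric] positive_nodes_subset[OF nodes n]) simp
  then have "M \<le> num_sign n (kwong p r) (- ((-1) ^ M))"
    using num_sign_submatrix_le[OF symmetric_on_kwong n, of p r "- ((-1) ^ M)"] by linarith
  moreover have "num_sign n (kwong p r) ((-1) ^ M) + num_zero n (kwong p r)
      + num_sign n (kwong p r) (- ((-1) ^ M)) = n"
    by (rule signature_total[OF symmetric_on_kwong]) simp
  ultimately show "num_sign n (kwong p r) ((-1) ^ M) = n - M"
    "num_sign n (kwong p r) (- ((-1) ^ M)) = M" "num_zero n (kwong p r) = 0"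
    using n by linarith+
qed

text \<open>Passing from size \<open>2 M + 1\<close> to \<open>2 M + 3\<close> the majority sign changes from \<open>(-1)\<^sup>M\<close> to
  \<open>(-1)\<^bsup>M+1\<^esup>\<close>, with \<open>M + 1\<close> and \<open>M + 2\<close> eigenvalues respectively. In the size between, the smaller matrix
  forces \<open>M + 1\<close> of the first sign and the larger one \<open>M + 1\<close> of the second.\<close>
lemma kwong_even_size_signature:
  assumes nodes: "positive_nodes (2 * Suc M) p" and r: "real (2 * Suc M) - 1 < r"
  shows "num_sign (2 * Suc M) (kwong p r) ((-1) ^ M) = Suc M"
    and "num_sign (2 * Suc M) (kwong p r) (- ((-1) ^ M)) = Suc M"
    and "num_zero (2 * Suc M) (kwong p r) = 0"
proof -
  let ?n = "2 * Suc M"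
  (* any further node beyond the last one will do for the larger matrix *)
  define q where "q = p(?n := p (?n - 1) + 1)"
  have kwong_q: "num_sign ?n (kwong q r) \<sigma> = num_sign ?n (kwong p r) \<sigma>" for \<sigma>
  proof -
    have "mat ?n ?n (\<lambda>(i, j). kwong q r i j) = mat ?n ?n (\<lambda>(i, j). kwong p r i j)"
      by (rule eq_matI) (auto simp: kwong_def q_def)
    then show ?thesis unfolding eig_count_def by simp
  qed
  have last: "p i \<le> p (?n - 1)" if "i < ?n" for i
    using positive_nodesD(2)[OF nodes, of i "?n - 1"] that by (cases "i = ?n - 1") auto
  have q_nodes: "positive_nodes (2 * Suc M + 1) q"
    unfolding positive_nodes_def
  proof (intro conjI allI impI)
    fix i assume "i < 2 * Suc M + 1"
    then show "0 < q i" using positive_nodesD(1)[OF nodes, of i] positive_nodesD(1)[OF nodes, of "?n - 1"]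
      by (cases "i = ?n") (auto simp: q_def)
  next
    fix i j assume "i < j" "j < 2 * Suc M + 1"
    then show "q i < q j" using positive_nodesD(2)[OF nodes, of i j] last[of i]
      by (cases "j = ?n") (auto simp: q_def)
  qed
  have "Suc M + 1 = num_sign (2 * Suc M + 1) (kwong q r) ((-1) ^ Suc M)"
    using r by (intro kwong_odd_size_signature[symmetric] q_nodes) simp
  also have "\<dots> \<le> num_sign ?n (kwong q r) ((-1) ^ Suc M) + (2 * Suc M + 1 - ?n)"
    by (rule num_sign_le_submatrix[OF symmetric_on_kwong]) simp
  also have "\<dots> = num_sign ?n (kwong p r) (- ((-1) ^ M)) + 1"
    unfolding kwong_q by simp
  finally have "Suc M \<le> num_sign ?n (kwong p r) (- ((-1) ^ M))" by simp
  moreover have "M + 1 = num_sign (2 * M + 1) (kwong p r) ((-1) ^ M)"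
    using r by (intro kwong_odd_size_signature[symmetric] positive_nodes_subset[OF nodes]) auto
  then have "Suc M \<le> num_sign ?n (kwong p r) ((-1) ^ M)"
    using num_sign_submatrix_le[OF symmetric_on_kwong, of "2 * M + 1" ?n p r "(-1) ^ M"] by simp
  moreover have "num_sign ?n (kwong p r) ((-1) ^ M) + num_zero ?n (kwong p r)
      + num_sign ?n (kwong p r) (- ((-1) ^ M)) = ?n"
    by (rule signature_total[OF symmetric_on_kwong]) simp
  moreover have "a = k \<and> b = k \<and> z = 0" if "k \<le> b" "k \<le> a" "a + z + b = 2 * k" for a b z k :: nat
    using that by linarith
  ultimately show "num_sign ?n (kwong p r) ((-1) ^ M) = Suc M"
    "num_sign ?n (kwong p r) (- ((-1) ^ M)) = Suc M" "num_zero ?n (kwong p r) = 0"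
    by blast+
qed

lemma odd_int_cases:
  fixes m :: int
  assumes "odd m" "m \<ge> -1"
  obtains M :: nat where "m = 2 * int M - 1"
proof -
  obtain k where "m = 2 * k + 1" using assms(1) by (elim oddE)
  then have "m = 2 * int (nat (k + 1)) - 1" using assms(2) by simp
  then show thesis by (rule that)
qed

theorem theorem1:
  fixes n :: nat and p :: "nat \<Rightarrow> real" and r :: real
  assumes "n > 0"
    and "\<forall>i<n. 0 < p i"
    and "\<forall>i j. i < j \<and> j < n \<longrightarrow> p i < p j"
    and "r > 0"
  shows
    "(\<not> invertible_mat (kwong_mat n p r) \<longleftrightarrow> (\<exists>m::int. odd m \<and> m < int n \<and> r = of_int m))
     \<and> (\<forall>m::int. odd m \<and> m \<le> int n \<and> r = of_int m \<longrightarrow>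
          (m mod 4 = 1 \<longrightarrow> kwong_inertia n p r = (nat \<lceil>r / 2\<rceil>, n - nat m, nat \<lfloor>r / 2\<rfloor>)) \<and>
          (m mod 4 = 3 \<longrightarrow> kwong_inertia n p r = (nat \<lfloor>r / 2\<rfloor>, n - nat m, nat \<lceil>r / 2\<rceil>)))
     \<and> (\<forall>k::int. odd k \<and> of_int k < r \<and> r < of_int k + 2 \<and> k + 2 < int n \<longrightarrow>
          (k mod 4 = 1 \<longrightarrow> kwong_inertia n p r =
             (nat \<lceil>real_of_int k / 2\<rceil>, 0, n - nat \<lceil>real_of_int k / 2\<rceil>)) \<and>
          (k mod 4 = 3 \<longrightarrow> kwong_inertia n p r =
             (n - nat \<lceil>real_of_int k / 2\<rceil>, 0, nat \<lceil>real_of_int k / 2\<rceil>)))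
     \<and> (odd n \<and> r > real n - 2 \<longrightarrow> kwong_inertia n p r = kwong_inertia n p (real n))
     \<and> (even n \<and> r > real n - 1 \<longrightarrow>
          kwong_inertia n p r = kwong_inertia n p (real n) \<and>
          kwong_inertia n p (real n) = (n div 2, 0, n div 2))"
proof (intro conjI)
  have nodes: "positive_nodes n p" using assms(2,3) unfolding positive_nodes_def by blast
  have mat: "kwong_mat n p s = mat n n (\<lambda>(i, j). kwong p s i j)" for s
    unfolding kwong_mat_def kwong_def ..
  have sign_cases: "kwong_inertia n p s = (if even M then (a, z, b) else (b, z, a))"
    if "num_sign n (kwong p s) ((-1) ^ M) = a" "num_sign n (kwong p s) (- ((-1) ^ M)) = b"
      "num_zero n (kwong p s) = z" for s M a b z
    unfolding kwong_inertia_eq using that by auto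
  have half: "nat \<lceil>real_of_int (2 * int M - 1) / 2\<rceil> = M" for M
  proof -
    have "\<lceil>real_of_int (2 * int M - 1) / 2\<rceil> = int M" by (rule ceiling_unique) auto
    then show ?thesis by simp
  qed
  have odd_inertia: "kwong_inertia n p (of_int m) = (if m mod 4 = 1
      then (nat \<lceil>real_of_int m / 2\<rceil>, n - nat m, nat \<lfloor>real_of_int m / 2\<rfloor>)
      else (nat \<lfloor>real_of_int m / 2\<rfloor>, n - nat m, nat \<lceil>real_of_int m / 2\<rceil>))"
    and odd_zero: "num_zero n (kwong p (of_int m)) = n - nat m"
    if m: "odd m" "0 < m" "m \<le> int n" for m :: int
  proof -
    obtain h where h: "m = 2 * int h + 1"
    proof -
      obtain k where k: "m = 2 * k + 1" using m(1) by (elim oddE)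
      then have "m = 2 * int (nat k) + 1" using m(2) by simp
      then show thesis by (rule that)
    qed
    then have hn: "2 * h + 1 \<le> n" and m_real: "real_of_int m = real (2 * h + 1)" and "nat m = 2 * h + 1"
      using m(3) by auto
    note sig = kwong_odd_signature[OF nodes hn]
    have "\<lfloor>real_of_int m / 2\<rfloor> = int h" "\<lceil>real_of_int m / 2\<rceil> = int h + 1"
      unfolding m_real by (auto intro!: floor_unique ceiling_unique)
    moreover have "m mod 4 = 1 \<longleftrightarrow> even h" unfolding h by presburger
    ultimately show "kwong_inertia n p (of_int m) = (if m mod 4 = 1
      then (nat \<lceil>real_of_int m / 2\<rceil>, n - nat m, nat \<lfloor>real_of_int m / 2\<rfloor>)
      else (nat \<lfloor>real_of_int m / 2\<rfloor>, n - nat m, nat \<lceil>real_of_int m / 2\<rceil>))"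
      using sign_cases[OF sig] \<open>nat m = _\<close> unfolding m_real by simp
    show "num_zero n (kwong p (of_int m)) = n - nat m"
      unfolding m_real \<open>nat m = _\<close> by (rule sig(3))
  qed

  show "\<not> invertible_mat (kwong_mat n p r) \<longleftrightarrow> (\<exists>m::int. odd m \<and> m < int n \<and> r = of_int m)"
  proof
    assume singular: "\<not> invertible_mat (kwong_mat n p r)"
    have "exceptional n r"
    proof (rule ccontr)
      assume "\<not> exceptional n r"
      then have "invertible_mat (kwong_mat n p r)"
        unfolding mat by (intro kernel_trivial_imp_invertible kwong_kernel_trivial[OF nodes])
      with singular show False ..
    qed
    then show "\<exists>m::int. odd m \<and> m < int n \<and> r = of_int m" unfolding exceptional_def by auto
  next
    assume "\<exists>m::int. odd m \<and> m < int n \<and> r = of_int m"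
    then obtain m :: int where m: "odd m" "m < int n" "r = of_int m" by blast
    then have "0 < num_zero n (kwong p r)" using odd_zero[of m] assms(4) by simp
    then show "\<not> invertible_mat (kwong_mat n p r)"
      unfolding mat using invertible_imp_num_zero[OF symmetric_on_kwong] by fastforce
  qed

  show "\<forall>m::int. odd m \<and> m \<le> int n \<and> r = of_int m \<longrightarrow>
      (m mod 4 = 1 \<longrightarrow> kwong_inertia n p r = (nat \<lceil>r / 2\<rceil>, n - nat m, nat \<lfloor>r / 2\<rfloor>)) \<and>
      (m mod 4 = 3 \<longrightarrow> kwong_inertia n p r = (nat \<lfloor>r / 2\<rfloor>, n - nat m, nat \<lceil>r / 2\<rceil>))"
    using odd_inertia assms(4) by auto

  show "\<forall>k::int. odd k \<and> of_int k < r \<and> r < of_int k + 2 \<and> k + 2 < int n \<longrightarrow>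
      (k mod 4 = 1 \<longrightarrow> kwong_inertia n p r =
         (nat \<lceil>real_of_int k / 2\<rceil>, 0, n - nat \<lceil>real_of_int k / 2\<rceil>)) \<and>
      (k mod 4 = 3 \<longrightarrow> kwong_inertia n p r =
         (n - nat \<lceil>real_of_int k / 2\<rceil>, 0, nat \<lceil>real_of_int k / 2\<rceil>))"
  proof (rule allI, rule impI)
    fix k :: int
    assume k: "odd k \<and> of_int k < r \<and> r < of_int k + 2 \<and> k + 2 < int n"
    then have "-2 < real_of_int k" using assms(4) by linarith
    then have "k \<ge> -1" by linarith
    then obtain M where M: "k = 2 * int M - 1" using k odd_int_cases by blast
    then have "2 * M + 1 \<le> n" "2 * real M - 1 < r" "r < 2 * real M + 1" using k by auto
    note sig = kwong_between_odd_signature[OF nodes this]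
    have "k mod 4 = 1 \<longrightarrow> odd M" "k mod 4 = 3 \<longrightarrow> even M" unfolding M by presburger+
    moreover have "nat \<lceil>real_of_int k / 2\<rceil> = M" unfolding M by (rule half)
    ultimately show "(k mod 4 = 1 \<longrightarrow> kwong_inertia n p r =
         (nat \<lceil>real_of_int k / 2\<rceil>, 0, n - nat \<lceil>real_of_int k / 2\<rceil>)) \<and>
      (k mod 4 = 3 \<longrightarrow> kwong_inertia n p r =
         (n - nat \<lceil>real_of_int k / 2\<rceil>, 0, nat \<lceil>real_of_int k / 2\<rceil>))"
      using sign_cases[OF sig] by auto
  qed

  show "odd n \<and> r > real n - 2 \<longrightarrow> kwong_inertia n p r = kwong_inertia n p (real n)"
  proof
    assume n: "odd n \<and> r > real n - 2"
    then obtain M where M: "n = 2 * M + 1" by (auto elim: oddE)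
    have inertia: "kwong_inertia n p s = (if even M then (M + 1, 0, M) else (M, 0, M + 1))"
      if "real n - 2 < s" for s
      using that nodes not_exceptional_tail[of M s] unfolding M
      by (intro sign_cases[unfolded M] kwong_odd_size_signature kwong_num_zero) auto
    show "kwong_inertia n p r = kwong_inertia n p (real n)"
      using inertia[of r] inertia[of "real n"] n by simp
  qed

  show "even n \<and> r > real n - 1 \<longrightarrow> kwong_inertia n p r = kwong_inertia n p (real n) \<and>
      kwong_inertia n p (real n) = (n div 2, 0, n div 2)"
  proof
    assume n: "even n \<and> r > real n - 1"
    then obtain M where M: "n = 2 * Suc M" using assms(1) by (metis evenE gr0_implies_Suc nat_0_less_mult_iff)
    have inertia: "kwong_inertia n p s = (n div 2, 0, n div 2)" if "real n - 1 < s" for s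
      using sign_cases[unfolded M, OF kwong_even_size_signature] that nodes unfolding M by simp
    show "kwong_inertia n p r = kwong_inertia n p (real n) \<and>
      kwong_inertia n p (real n) = (n div 2, 0, n div 2)"
      using inertia[of r] inertia[of "real n"] n by simp
  qed
qed

end
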